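(* Let $G$ be an infinite bounded Abelian group. Then all countable (finite or infinite) subgroups of $G$ belong to $\mathcal{NR}(G)$ if and only if all leading Ulm-Kaplansky invariants of $G$ are infinite. In such a case, all countable (finite or infinite) subgroups of $G$ belong to $\mathcal{NRC}(G)$.
   Context: $G$ is bounded if $\exp G<\infty$, where $\exp G$ is the least common multiple of the orders of the elements of $G$. A bounded Abelian group $G$ has the form $G=\bigoplus_{p\in M}\bigoplus_{i=1}^{n_p}\mathbb{Z}(p^i)^{(k_{i,p})}$, where $M$ is a finite set of primes, the $k_{i,p}$ are cardinals, and $k_{n_p,p}\neq 0$ for each $p\in M$ (so $p^{n_p}$ is the exponent of the $p$-component). The leading Ulm-Kaplansky invariants of $G$ are the cardinals $k_{n_p,p}$, $p\in M$. For a topological Abelian group $X$, $X^\wedge$ is the group of continuous characters (continuous homomorphisms to the circle group), and $\mathbf{n}(X)=\bigcap_{\chi\in X^\wedge}\ker\chi$ is the von Neumann radical of $X$. For an infinite Abelian group $G$, $\mathcal{NR}(G)$ (respectively $\mathcal{NRC}(G)$) is the set of all subgroups $H$ of $G$ for which there exists a non-discrete Hausdorff (respectively complete non-discrete Hausdorff) group topology $\tau$ on $G$ with $\mathbf{n}(G,\tau)=H$. *)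

theory Defs
  imports "HOL-Analysis.Analysis" "HOL-Algebra.Multiplicative_Group" "HOL-Algebra.Elementary_Groups"
    "HOL-Algebra.Product_Groups"
begin

text \<open>
  The least common multiple of an infinite set of naturals, and of any set containing \<open>0\<close>, is \<open>0\<close>;
  elements of infinite order have \<open>group.ord\<close> equal to \<open>0\<close>.
  Hence the value \<open>0\<close> stands for an infinite exponent.
\<close>

definition group_exponent :: "('a, 'b) monoid_scheme \<Rightarrow> nat" where
  "group_exponent G = Lcm (group.ord G ` carrier G)"

definition bounded_group :: "('a, 'b) monoid_scheme \<Rightarrow> bool" where
  "bounded_group G \<longleftrightarrow> group_exponent G \<noteq> 0"

text \<open>
  The cardinal \<open>k\<^bsub>i,p\<^esub>\<close> is represented by an index set \<open>K p i\<close> of that cardinality. The index sets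
  can be taken in the type of the elements of \<open>G\<close> because each \<open>k\<^bsub>i,p\<^esub>\<close> is at most the cardinality
  of \<open>G\<close>.
\<close>

definition cyclic_decomposition ::
  "('a, 'b) monoid_scheme \<Rightarrow> nat set \<Rightarrow> (nat \<Rightarrow> nat) \<Rightarrow> (nat \<Rightarrow> nat \<Rightarrow> 'a set) \<Rightarrow> bool" where
  "cyclic_decomposition G M n K \<longleftrightarrow>
     finite M \<and> (\<forall>p\<in>M. Factorial_Ring.prime p \<and> 1 \<le> n p \<and> K p (n p) \<noteq> {}) \<and>
     G \<cong> sum_group {(p, i, x). p \<in> M \<and> 1 \<le> i \<and> i \<le> n p \<and> x \<in> K p i}
                   (\<lambda>(p, i, x). integer_mod_group (p ^ i))"

text \<open>
  Cardinals are represented by cardinal orders. The decomposition is unique only up to the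
  equipollence classes of its index sets, so every leading invariant occurs here once for each
  choice of the index set.
\<close>

definition leading_Ulm_Kaplansky_invariants :: "('a, 'b) monoid_scheme \<Rightarrow> 'a rel set" where
  "leading_Ulm_Kaplansky_invariants G =
     {card_of (K p (n p)) | M n K p. cyclic_decomposition G M n K \<and> p \<in> M}"

definition group_topology :: "('a, 'b) monoid_scheme \<Rightarrow> 'a topology \<Rightarrow> bool" where
  "group_topology G T \<longleftrightarrow>
     topspace T = carrier G \<and>
     continuous_map (prod_topology T T) T (\<lambda>(x, y). x \<otimes>\<^bsub>G\<^esub> y) \<and>
     continuous_map T T (\<lambda>x. inv\<^bsub>G\<^esub> x)"

definition circle_group :: "complex monoid" where
  "circle_group = \<lparr>carrier = sphere 0 1, monoid.mult = (*), one = 1\<rparr>"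

definition continuous_characters ::
  "('a, 'b) monoid_scheme \<Rightarrow> 'a topology \<Rightarrow> ('a \<Rightarrow> complex) set" where
  "continuous_characters G T =
     {h \<in> hom G circle_group. continuous_map T (top_of_set (sphere 0 1)) h}"

definition von_Neumann_radical :: "('a, 'b) monoid_scheme \<Rightarrow> 'a topology \<Rightarrow> 'a set" where
  "von_Neumann_radical G T = (\<Inter>h\<in>continuous_characters G T. kernel G circle_group h)"

text \<open>
  Completeness with respect to the group uniformity; for Abelian groups the left, right and
  two-sided uniformities coincide.
\<close>

definition cauchy_filter_on_group ::
  "('a, 'b) monoid_scheme \<Rightarrow> 'a topology \<Rightarrow> 'a filter \<Rightarrow> bool" where
  "cauchy_filter_on_group G T F \<longleftrightarrow>
     F \<noteq> bot \<and> F \<le> principal (carrier G) \<and>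
     (\<forall>U. openin T U \<and> \<one>\<^bsub>G\<^esub> \<in> U \<longrightarrow>
        eventually (\<lambda>(x, y). x \<otimes>\<^bsub>G\<^esub> inv\<^bsub>G\<^esub> y \<in> U) (F \<times>\<^sub>F F))"

definition complete_group_topology :: "('a, 'b) monoid_scheme \<Rightarrow> 'a topology \<Rightarrow> bool" where
  "complete_group_topology G T \<longleftrightarrow>
     (\<forall>F. cauchy_filter_on_group G T F \<longrightarrow> (\<exists>l. limitin T (\<lambda>x. x) l F))"

definition NR :: "('a, 'b) monoid_scheme \<Rightarrow> 'a set set" where
  "NR G = {H. subgroup H G \<and>
     (\<exists>T. group_topology G T \<and> T \<noteq> discrete_topology (carrier G) \<and> Hausdorff_space T \<and>
          von_Neumann_radical G T = H)}"

definition NRC :: "('a, 'b) monoid_scheme \<Rightarrow> 'a set set" where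
  "NRC G = {H. subgroup H G \<and>
     (\<exists>T. group_topology G T \<and> complete_group_topology G T \<and>
          T \<noteq> discrete_topology (carrier G) \<and> Hausdorff_space T \<and>
          von_Neumann_radical G T = H)}"

end

theory Submission
  imports Defs "HOL-Algebra.Free_Abelian_Groups"
begin

text \<open>
  \<^emph>\<open>If a leading invariant is finite.\<close> Let \<open>G\<close> be the sum of cyclic groups given by a decomposition,
  let \<open>N\<close> be the exponent and suppose that the summands of order \<open>p\<^sup>n\<close>, with \<open>p\<^sup>n\<close> the exact power of \<open>p\<close>
  in \<open>N\<close>, are finite in number. Multiplication by \<open>N/p\<close> (written as a power below) kills everything
  except the tops of these summands, so its image is finite. In a Hausdorff group topology it is therefore
  a continuous homomorphism onto a finite discrete group, and any character that factors through it is
  continuous. A generator of one of these summands is not killed by some such character and generates a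
  finite subgroup that is not a radical (\<open>finite_leading_invariant_imp_not_NR\<close>). The
  assumption on the leading invariants says nothing unless a decomposition exists, so the theorem that
  bounded Abelian groups are sums of cyclic groups (\<open>cyclic_decomposition_exists\<close>) is part
  of the proof.

  \<^emph>\<open>If all leading invariants are infinite.\<close> Then the image of multiplication by \<open>N/p\<close> is infinite for every prime
  \<open>p\<close> dividing \<open>N\<close>. Hence any finite subgroup \<open>F\<close> and any finite set of characters leave room for an
  element \<open>e\<close> that is killed by the characters and has order \<open>N\<close> modulo \<open>F\<close>
  (\<open>element_independent_of_finite_subgroup\<close>).
  Given a countable subgroup \<open>H\<close>, list its elements as \<open>h\<^sub>0, h\<^sub>1, \<dots>\<close>, each infinitely often, and choose
  \<open>e\<^sub>0, e\<^sub>1, \<dots>\<close> one after the other, each of order \<open>N\<close> modulo the subgroup generated by its predecessors and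
  an initial segment of the \<open>h\<^sub>k\<close>. Group the \<open>e\<^sub>i\<close> into blocks of size \<open>2\<^sup>k\<close>, and take the finest group topology in which
  the \<open>e\<^sub>i\<close> and the elements \<open>h\<^sub>k - \<Sum>e\<^sub>i\<close>, the sum over the \<open>k\<close>-th block, tend to zero.

  A continuous character takes values in the \<open>N\<close>-th roots of unity, so it is eventually exactly \<open>1\<close> on a null sequence;
  since \<open>h\<^sub>k\<close> is a sum of members of the \<open>k\<close>-th block, the character is \<open>1\<close> on \<open>H\<close>. Conversely, the decomposition of \<open>G/H\<close>
  yields characters that vanish on \<open>H\<close> and separate the points outside \<open>H\<close>, and the \<open>e\<^sub>i\<close> are chosen so that each of
  these is nontrivial at no more than one \<open>e\<^sub>i\<close>; hence they are continuous and the radical is \<open>H\<close>.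
  The topology is Hausdorff because the elements of \<open>H\<close> are expensive combinations of the null sequence: a
  suitable neighbourhood of zero consists of sums that use only blocks after the \<open>j\<close>-th and fewer than \<open>2\<^sup>k\<close> summands from the
  \<open>k\<close>-th block, and by independence each block contributes zero to such a sum if its value is \<open>h\<^sub>j\<close> (\<open>nbhd_separates\<close>).
  It is complete because the group generated by the null sequence is the union of an increasing sequence of compact sets
  to which the neighbourhoods are adapted (\<open>complete_block_topology\<close>).
\<close>

section \<open>Bounded groups are direct sums of cyclic groups\<close>

locale bounded_comm_group = comm_group G for G (structure) +
  fixes N :: nat
  assumes N_pos: "N > 0" and pow_N: "x \<in> carrier G \<Longrightarrow> x [^] N = \<one>"
begin

lemma ord_dvd_N: "x \<in> carrier G \<Longrightarrow> ord x dvd N"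
  using pow_N pow_eq_id by blast

lemma ord_pos: "x \<in> carrier G \<Longrightarrow> ord x > 0"
  using ord_dvd_N N_pos by (metis dvd_0_left_iff gr0I)

lemma ord_le_N: "x \<in> carrier G \<Longrightarrow> ord x \<le> N"
  using ord_dvd_N N_pos by (simp add: dvd_imp_le)

end

context comm_group
begin

lemma subgroup_finprod_closed:
  assumes "subgroup H G" "\<And>i. i \<in> A \<Longrightarrow> f i \<in> H"
  shows "finprod G f A \<in> H"
proof (cases "finite A")
  case True
  then show ?thesis using assms(2)
  proof (induction A rule: finite_induct)
    case empty
    then show ?case using subgroup.one_closed[OF assms(1)] by simp
  next
    case (insert a A)
    have sub: "H \<subseteq> carrier G" using assms(1) subgroup.subset by blast
    have "finprod G f (insert a A) = f a \<otimes> finprod G f A"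
      using insert sub by (intro finprod_insert) auto
    then show ?case using insert subgroup.m_closed[OF assms(1)] by simp
  qed
next
  case False
  then show ?thesis using subgroup.one_closed[OF assms(1)] by simp
qed

lemma finprod_int_pow:
  assumes "f \<in> A \<rightarrow> carrier G"
  shows "finprod G f A [^] (k::int) = finprod G (\<lambda>i. f i [^] k) A"
proof (cases "finite A")
  case True
  then show ?thesis using assms
  proof (induction A rule: finite_induct)
    case (insert a A)
    have "finprod G f (insert a A) = f a \<otimes> finprod G f A"
      using insert by (intro finprod_insert) auto
    moreover have "finprod G (\<lambda>i. f i [^] k) (insert a A) = f a [^] k \<otimes> finprod G (\<lambda>i. f i [^] k) A"
      using insert by (intro finprod_insert) auto
    moreover have "f a \<in> carrier G" "finprod G f A \<in> carrier G"
      using insert by (auto intro: finprod_closed)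
    ultimately show ?case using insert by (simp add: int_pow_distrib)
  qed simp
qed simp

definition p_elements :: "nat \<Rightarrow> 'a set" where
  "p_elements p = {y \<in> carrier G. \<exists>k\<ge>1. ord y = p ^ k}"

definition socle_power :: "nat \<Rightarrow> 'a \<Rightarrow> 'a" where
  "socle_power p y = y [^] (ord y div p)"

text \<open>
  Scanning the elements of \<open>p\<close>-power order along \<open>R\<close>, keep those whose associated element of order \<open>p\<close> is
  independent of the earlier ones. When \<open>R\<close> lists elements of larger order first, this
  selects a basis of the \<open>p\<close>-socle that is adapted to the filtration by height.
\<close>
definition greedy_basis :: "'a rel \<Rightarrow> nat \<Rightarrow> 'a set" where
  "greedy_basis R p = {y \<in> p_elements p.
     socle_power p y \<notin> generate G (socle_power p ` {z \<in> p_elements p. (z, y) \<in> R})}"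

lemma p_elements_carrier: "y \<in> p_elements p \<Longrightarrow> y \<in> carrier G"
  by (simp add: p_elements_def)

lemma greedy_basis_subset: "greedy_basis R p \<subseteq> p_elements p"
  by (auto simp: greedy_basis_def)

lemma socle_power_closed: "y \<in> p_elements p \<Longrightarrow> socle_power p y \<in> carrier G"
  by (simp add: p_elements_def socle_power_def)

end

context bounded_comm_group
begin

text \<open>
  Ties between elements of equal order are broken by a well-ordering of the type. Larger orders come first, and this remains
  well-founded because the orders are bounded by \<open>N\<close>.
\<close>
lemma decreasing_order_well_ordering:
  obtains R :: "'a rel" where "wf R" "trans R"
    "\<And>x y. \<lbrakk>x \<in> carrier G; y \<in> carrier G; x \<noteq> y\<rbrakk> \<Longrightarrow> (x, y) \<in> R \<or> (y, x) \<in> R"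
    "\<And>x y. (x, y) \<in> R \<Longrightarrow> ord y \<le> ord x"
proof -
  obtain r :: "'a rel" where r: "well_order_on UNIV r"
    using well_order_on by blast
  define W where "W = r - Id"
  have wfW: "wf W" using r unfolding W_def well_order_on_def by blast
  have lin: "linear_order_on UNIV r" using r by (simp add: well_order_on_def)
  have trW: "trans W"
    using lin unfolding W_def linear_order_on_def partial_order_on_def preorder_on_def
    by (auto intro!: trans_diff_Id)
  have totW: "x \<noteq> y \<Longrightarrow> (x,y) \<in> W \<or> (y,x) \<in> W" for x y
    using lin unfolding W_def linear_order_on_def total_on_def by auto
  define R where "R = {(x,y). x \<in> carrier G \<and> y \<in> carrier G \<and>
     (ord y < ord x \<or> ord x = ord y \<and> (x,y) \<in> W)}"
  have "R \<subseteq> inv_image (less_than <*lex*> W) (\<lambda>x. (N - ord x, x))"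
    using ord_le_N by (auto simp: R_def intro: diff_less_mono2 dest: le_neq_trans)
      (metis diff_less_mono2 less_le_trans)+
  moreover have "wf (inv_image (less_than <*lex*> W) (\<lambda>x. (N - ord x, x)))"
    using wfW by (intro wf_inv_image wf_lex_prod) auto
  ultimately have "wf R" using wf_subset by blast
  moreover have "trans R"
    using trW unfolding R_def trans_def by auto
  moreover have "(x, y) \<in> R \<or> (y, x) \<in> R" if "x \<in> carrier G" "y \<in> carrier G" "x \<noteq> y" for x y
    using that totW unfolding R_def by (auto simp: not_less_iff_gr_or_eq)
  moreover have "ord y \<le> ord x" if "(x, y) \<in> R" for x y
    using that by (auto simp: R_def)
  ultimately show ?thesis using that by blast
qed

end

context comm_group
begin

text \<open>
  In the application \<open>S z\<close> is \<open>socle_power p z\<close> for elements \<open>z\<close> of large order, and the conclusion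
  lifts an element of the socle to a root in the span of the \<open>z\<close>.
\<close>
lemma generate_roots:
  assumes A: "A \<subseteq> carrier G" and S: "\<And>z. z \<in> A \<Longrightarrow> \<exists>m::nat. S z = z [^] (m * j)"
    and x: "x \<in> generate G (S ` A)"
  shows "\<exists>x'\<in>generate G A. x' [^] j = x"
  using x
proof (induction rule: generate.induct)
  case one
  then show ?case using generate.one by force
next
  case (incl h)
  then obtain z m where z: "z \<in> A" "h = z [^] (m * j)" using S by blast
  have "z [^] m \<in> generate G A"
    using z A generate.incl generate_is_subgroup[OF A] by (metis int_pow_int subgroup_int_pow_closed)
  moreover have "(z [^] m) [^] j = h" using z A by (auto simp: nat_pow_pow)
  ultimately show ?case by blast
next
  case (inv h)
  then obtain z m where z: "z \<in> A" "h = z [^] (m * j)" using S by blast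
  have zc: "z \<in> carrier G" using z A by auto
  have "z [^] m \<in> generate G A"
    using z A generate.incl generate_is_subgroup[OF A] by (metis int_pow_int subgroup_int_pow_closed)
  then have "inv (z [^] m) \<in> generate G A" using A generate_m_inv_closed by blast
  moreover have "(inv (z [^] m)) [^] j = inv h" using z zc by (simp add: nat_pow_pow nat_pow_inv)
  ultimately show ?case by blast
next
  case (eng h1 h2)
  then obtain x1 x2 where x: "x1 \<in> generate G A" "x1 [^] j = h1" "x2 \<in> generate G A" "x2 [^] j = h2"
    by blast
  then have "(x1 \<otimes> x2) [^] j = h1 \<otimes> h2"
    using A generate_in_carrier by (metis nat_pow_distrib)
  then show ?case using x generate.eng by metis
qed

end

context bounded_comm_group
begin

context
  fixes R :: "'a rel"
  assumes wfR: "wf R" and transR: "trans R"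
    and totalR: "\<And>x y. \<lbrakk>x \<in> carrier G; y \<in> carrier G; x \<noteq> y\<rbrakk> \<Longrightarrow> (x, y) \<in> R \<or> (y, x) \<in> R"
    and ordR: "\<And>x y. (x, y) \<in> R \<Longrightarrow> ord y \<le> ord x"
begin

lemma socle_power_generated:
  assumes "y \<in> p_elements p"
  shows "socle_power p y \<in> generate G (socle_power p ` {z \<in> greedy_basis R p. z = y \<or> (z, y) \<in> R})"
  using wfR assms
proof (induction y rule: wf_induct_rule)
  case (less y)
  let ?B = "\<lambda>y. socle_power p ` {z \<in> greedy_basis R p. z = y \<or> (z, y) \<in> R}"
  show ?case
  proof (cases "y \<in> greedy_basis R p")
    case True
    then show ?thesis by (auto intro: generate.incl)
  next
    case False
    then have "socle_power p y \<in> generate G (socle_power p ` {z \<in> p_elements p. (z, y) \<in> R})"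
      using less.prems by (auto simp: greedy_basis_def)
    moreover have "generate G (socle_power p ` {z \<in> p_elements p. (z, y) \<in> R}) \<subseteq> generate G (?B y)"
    proof (rule generate_subgroup_incl)
      show "subgroup (generate G (?B y)) G"
        using greedy_basis_subset socle_power_closed by (intro generate_is_subgroup) blast
      show "socle_power p ` {z \<in> p_elements p. (z, y) \<in> R} \<subseteq> generate G (?B y)"
      proof clarify
        fix z assume z: "z \<in> p_elements p" "(z, y) \<in> R"
        then have "socle_power p z \<in> generate G (?B z)" using less.IH by blast
        moreover have "?B z \<subseteq> ?B y" using z transR by (auto dest: transD)
        ultimately show "socle_power p z \<in> generate G (?B y)" using mono_generate by blast
      qed
    qed
    ultimately show ?thesis by blast
  qed
qed

text \<open>
  If \<open>y\<close> has order \<open>p\<^sup>k\<^sup>+\<^sup>1\<close>, its socle element is a combination of socle elements of basis members of at least the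
  same order, since those come first in \<open>R\<close>. It is therefore the \<open>p\<^sup>k\<close>-th power of some \<open>x'\<close> in the span of the basis,
  and \<open>y\<close> differs from \<open>x'\<close> by an element of smaller order.
\<close>
lemma p_power_torsion_generated:
  assumes p: "Factorial_Ring.prime p"
  shows "\<lbrakk>y \<in> carrier G; y [^] (p ^ k) = \<one>\<rbrakk> \<Longrightarrow> y \<in> generate G (greedy_basis R p)"
proof (induction k arbitrary: y)
  case 0
  then show ?case by (simp add: generate.one)
next
  case (Suc k)
  have Bc: "greedy_basis R p \<subseteq> carrier G"
    using greedy_basis_subset p_elements_carrier by blast
  show ?case
  proof (cases "y [^] (p ^ k) = \<one>")
    case True
    then show ?thesis using Suc by blast
  next
    case False
    have "ord y dvd p ^ Suc k" "\<not> ord y dvd p ^ k"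
      using Suc.prems False pow_eq_id by blast+
    then have ordy: "ord y = p ^ Suc k"
      using p by (metis divides_primepow_nat le_imp_power_dvd not_less_eq_eq le_antisym)
    then have yp: "y \<in> p_elements p" using Suc.prems by (auto simp: p_elements_def intro!: exI[of _ "Suc k"])
    have Sy: "socle_power p y = y [^] (p ^ k)"
      using ordy p by (simp add: socle_power_def prime_gt_0_nat)
    let ?A = "{z \<in> greedy_basis R p. z = y \<or> (z, y) \<in> R}"
    have "\<exists>m. socle_power p z = z [^] (m * p ^ k)" if z: "z \<in> ?A" for z
    proof -
      obtain l where l: "ord z = p ^ l" "l \<ge> 1" using z greedy_basis_subset[of R p] unfolding p_elements_def by blast
      have "ord y \<le> ord z" using z ordR[of z y] by auto
      then have "p ^ Suc k \<le> p ^ l" using ordy l by simp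
      then have "Suc k \<le> l" using p by (meson power_le_imp_le_exp prime_gt_1_nat)
      moreover have "ord z div p = p ^ (l - 1)"
        using l p by (metis One_nat_def power_diff prime_gt_0_nat neq0_conv power_one_right)
      ultimately have "ord z div p = p ^ (l - 1 - k) * p ^ k"
        by (simp flip: power_add)
      then show ?thesis unfolding socle_power_def by metis
    qed
    moreover have "socle_power p y \<in> generate G (socle_power p ` ?A)"
      using socle_power_generated[OF yp] .
    moreover have "?A \<subseteq> carrier G" using Bc by auto
    ultimately obtain x' where x': "x' \<in> generate G ?A" "x' [^] (p ^ k) = socle_power p y"
      using generate_roots by (metis (no_types, lifting))
    then have x'B: "x' \<in> generate G (greedy_basis R p)"
      using mono_generate[of ?A "greedy_basis R p"] by blast
    then have x'c: "x' \<in> carrier G" using Bc generate_in_carrier by blast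
    have "(y \<otimes> inv x') [^] (p ^ k) = \<one>"
      using x' Sy x'c Suc.prems by (simp add: nat_pow_distrib nat_pow_inv r_inv)
    then have "y \<otimes> inv x' \<in> generate G (greedy_basis R p)" using Suc x'c by simp
    then have "(y \<otimes> inv x') \<otimes> x' \<in> generate G (greedy_basis R p)" using x'B generate.eng by metis
    then show ?thesis using x'c Suc.prems by (simp add: m_assoc l_inv)
  qed
qed

text \<open>Splitting off one prime power from the order of \<open>g\<close> reduces the claim to elements of smaller order.\<close>
lemma carrier_generated:
  assumes "g \<in> carrier G"
  shows "g \<in> generate G (\<Union>p\<in>Collect Factorial_Ring.prime. greedy_basis R p)"
  using assms
proof (induction "ord g" arbitrary: g rule: less_induct)
  case less
  let ?B = "\<Union>p\<in>Collect Factorial_Ring.prime. greedy_basis R p"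
  have Bc: "?B \<subseteq> carrier G"
    using greedy_basis_subset p_elements_carrier by blast
  show ?case
  proof (cases "ord g = 1")
    case True
    then show ?thesis using less.prems ord_eq_1 generate.one by metis
  next
    case False
    then obtain p where p: "Factorial_Ring.prime p" "p dvd ord g" using prime_factor_nat by blast
    obtain m where m: "ord g = p ^ multiplicity p (ord g) * m" "\<not> p dvd m"
      using multiplicity_decompose'[of "ord g" p] ord_pos[OF less.prems] p(1)
      by (metis not_prime_unit less_irrefl)
    define k where "k = multiplicity p (ord g)"
    have ordg: "ord g = p ^ k * m" using m by (simp add: k_def)
    have k: "k \<noteq> 0" using p m ordg by (metis mult_1 power_0)
    have cop: "coprime (p ^ k) m" using p m by (simp add: prime_imp_coprime)
    obtain a b where ab: "int (p ^ k) * a + int m * b = 1"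
      using bezout_int[of "int (p^k)" "int m"] cop
      by (metis coprime_int_iff coprime_iff_gcd_eq_1 mult.commute)
    have "ord (g [^] (p ^ k)) = m"
      using ord_pow[OF less.prems, of "p ^ k"] ordg p(1) by (simp add: prime_gt_0_nat)
    moreover have "m < ord g"
    proof -
      have "p ^ k > 1" using k p by (metis prime_gt_1_nat one_less_power neq0_conv)
      then show ?thesis using ordg ord_pos[OF less.prems] by auto
    qed
    ultimately have 1: "g [^] (p ^ k) \<in> generate G ?B" using less by simp
    have "(g [^] m) [^] (p ^ k) = \<one>"
      using ordg pow_ord_eq_1[OF less.prems] by (simp add: nat_pow_pow less.prems mult.commute)
    then have "g [^] m \<in> generate G (greedy_basis R p)"
      using p_power_torsion_generated p less.prems by blast
    then have 2: "g [^] m \<in> generate G ?B"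
      using mono_generate[of "greedy_basis R p" ?B] p by blast
    have "g = g [^] (int (p ^ k) * a + int m * b)" using ab less.prems by simp
    also have "\<dots> = (g [^] (p ^ k)) [^] a \<otimes> (g [^] m) [^] b"
      using less.prems by (simp add: int_pow_mult int_pow_pow flip: int_pow_int)
    finally show ?thesis
      using 1 2 subgroup_int_pow_closed[OF generate_is_subgroup[OF Bc]]
      by (metis generate.eng)
  qed
qed


lemma R_greatest:
  assumes "finite A" "A \<noteq> {}" "A \<subseteq> carrier G"
  shows "\<exists>m\<in>A. \<forall>z\<in>A. z \<noteq> m \<longrightarrow> (z, m) \<in> R"
  using assms
proof (induction A rule: finite_ne_induct)
  case (insert a A)
  then obtain m where m: "m \<in> A" "\<forall>z\<in>A. z \<noteq> m \<longrightarrow> (z, m) \<in> R" by auto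
  then have "m \<noteq> a" using insert by auto
  then consider "(m, a) \<in> R" | "(a, m) \<in> R" using totalR[of m a] m insert.prems by auto
  then show ?case
  proof cases
    case 1
    then have "\<forall>z\<in>insert a A. z \<noteq> a \<longrightarrow> (z, a) \<in> R" using m transR by (metis insertE transD)
    then show ?thesis by blast
  next
    case 2
    then show ?thesis using m by blast
  qed
qed auto

text \<open>
  In a relation between socle elements, the last basis element in the order \<open>R\<close> would be
  a combination of earlier ones, contrary to its selection.
\<close>
lemma greedy_basis_no_relation:
  assumes p: "Factorial_Ring.prime p" and A: "finite A" "A \<noteq> {}" "A \<subseteq> greedy_basis R p"
    and f: "\<And>y. y \<in> A \<Longrightarrow> \<not> int p dvd f y"
    and rel: "finprod G (\<lambda>y. socle_power p y [^] (f y :: int)) A = \<one>"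
  shows False
proof -
  have Ap: "A \<subseteq> p_elements p" using A(3) greedy_basis_subset by blast
  then have Ac: "A \<subseteq> carrier G" using p_elements_carrier by blast
  obtain m where m: "m \<in> A" "\<forall>z\<in>A. z \<noteq> m \<longrightarrow> (z, m) \<in> R"
    using R_greatest[OF A(1,2) Ac] by blast
  let ?H = "generate G (socle_power p ` {z \<in> p_elements p. (z, m) \<in> R})"
  have sub: "subgroup ?H G" using socle_power_closed by (intro generate_is_subgroup) blast
  let ?t = "\<lambda>y. socle_power p y [^] f y"
  have tc: "?t \<in> A \<rightarrow> carrier G" using Ap socle_power_closed by auto
  have "finprod G ?t (insert m (A - {m})) = ?t m \<otimes> finprod G ?t (A - {m})"
    using A(1) m(1) tc by (intro finprod_insert) auto
  then have eq: "?t m \<otimes> finprod G ?t (A - {m}) = \<one>"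
    using rel m(1) by (simp add: insert_absorb)
  have in_H: "finprod G ?t (A - {m}) \<in> ?H"
  proof (rule subgroup_finprod_closed[OF sub])
    fix i assume "i \<in> A - {m}"
    then have "socle_power p i \<in> ?H" using m Ap by (auto intro!: generate.incl)
    then show "?t i \<in> ?H" using sub subgroup_int_pow_closed by blast
  qed
  then have fc: "finprod G ?t (A - {m}) \<in> carrier G" using sub subgroup.subset by blast
  have tm: "?t m \<in> carrier G" using tc m by auto
  have "?t m = inv (finprod G ?t (A - {m}))" using eq fc tm by (simp add: inv_equality)
  then have tmH: "?t m \<in> ?H" using in_H subgroup.m_inv_closed[OF sub] by simp
  have "coprime (int p) (f m)" using p f[OF m(1)] by (simp add: prime_imp_coprime)
  then obtain a b where ab: "a * int p + b * f m = 1"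
    using bezout_int[of "int p" "f m"] by auto
  have mc: "m \<in> carrier G" using m Ac by auto
  have Sm: "socle_power p m \<in> carrier G" using m Ap socle_power_closed by blast
  have "p dvd ord m" using m Ap by (auto simp: p_elements_def dvd_power)
  then have "socle_power p m [^] p = \<one>"
    using mc by (simp add: socle_power_def nat_pow_pow)
  then have Smp: "socle_power p m [^] int p = \<one>" by (simp add: int_pow_int)
  have "socle_power p m = socle_power p m [^] (int p * a + f m * b)"
    using ab Sm by (simp add: mult.commute)
  also have "\<dots> = (socle_power p m [^] int p) [^] a \<otimes> ?t m [^] b"
    using Sm by (simp add: int_pow_mult int_pow_pow)
  also have "\<dots> = ?t m [^] b" using Smp tm by simp
  finally have "socle_power p m \<in> ?H" using tmH sub subgroup_int_pow_closed by metis
  then show False using m A(3) by (auto simp: greedy_basis_def)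
qed

text \<open>
  A suitable power of a nontrivial relation is a nontrivial relation between socle elements for a single prime \<open>p\<close>:
  raise it to the part \<open>N'\<close> of \<open>N\<close> prime to \<open>p\<close>, which kills the terms that belong to other primes, and then to
  the largest power of \<open>p\<close> that does not kill everything.
\<close>
lemma basis_independent:
  assumes A: "finite A" "A \<subseteq> (\<Union>p\<in>Collect Factorial_Ring.prime. greedy_basis R p)"
    and rel: "finprod G (\<lambda>y. y [^] (c y :: int)) A = \<one>" and y0: "y0 \<in> A"
  shows "y0 [^] c y0 = \<one>"
proof (rule ccontr)
  assume ne: "y0 [^] c y0 \<noteq> \<one>"
  have Ac: "A \<subseteq> carrier G" using A greedy_basis_subset p_elements_carrier by blast
  obtain p where p: "Factorial_Ring.prime p" and y0p: "y0 \<in> greedy_basis R p" using A y0 by blast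
  obtain N' where N': "N = p ^ multiplicity p N * N'" "\<not> p dvd N'"
    using multiplicity_decompose'[of N p] N_pos p by (metis not_prime_unit less_irrefl)
  define n where "n = multiplicity p N"
  have Nn: "N = p ^ n * N'" using N' by (simp add: n_def)
  have copN': "coprime (p ^ k) N'" for k using p N' by (simp add: prime_imp_coprime)
  define P where "P = (\<lambda>t. \<forall>y\<in>A \<inter> greedy_basis R p. y [^] (c y * int (N' * p ^ t)) = \<one>)"
  have "P n"
  proof (unfold P_def, intro ballI)
    fix y assume "y \<in> A \<inter> greedy_basis R p"
    then have "y [^] c y \<in> carrier G" "y \<in> carrier G" using Ac by auto
    then have "(y [^] c y) [^] N = \<one>" using pow_N by blast
    then show "y [^] (c y * int (N' * p ^ n)) = \<one>"
      using Nn \<open>y \<in> carrier G\<close> by (simp add: int_pow_pow mult.commute flip: int_pow_int)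
  qed
  define t where "t = (LEAST t. P t)"
  have Pt: "P t" unfolding t_def using \<open>P n\<close> by (rule LeastI)
  have "\<not> P 0"
  proof
    assume "P 0"
    then have 1: "y0 [^] (c y0 * int N') = \<one>" using y0 y0p by (auto simp: P_def)
    have y0c: "y0 \<in> carrier G" using y0 Ac by auto
    obtain k where k: "ord y0 = p ^ k" using y0p greedy_basis_subset[of R p] unfolding p_elements_def by blast
    have "int (p ^ k) dvd c y0 * int N'" using 1 k int_pow_eq_id[OF y0c] by simp
    moreover have "coprime (int (p ^ k)) (int N')" using copN' by simp
    ultimately have "int (p ^ k) dvd c y0" using coprime_dvd_mult_left_iff by blast
    then show False using ne k int_pow_eq_id[OF y0c] by simp
  qed
  then have "t \<noteq> 0" using Pt by metis
  then obtain t' where t': "t = Suc t'" using not0_implies_Suc by blast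
  then have nP: "\<not> P t'" unfolding t_def by (metis lessI not_less_Least)
  define d where "d = (\<lambda>y. c y * int (N' * p ^ t'))"
  have rel_d: "finprod G (\<lambda>y. y [^] d y) A = \<one>"
  proof -
    have "finprod G (\<lambda>y. y [^] c y) A [^] int (N' * p ^ t') = finprod G (\<lambda>y. (y [^] c y) [^] int (N' * p ^ t')) A"
      using Ac by (intro finprod_int_pow) auto
    also have "\<dots> = finprod G (\<lambda>y. y [^] d y) A"
      using Ac by (intro finprod_cong') (auto simp: int_pow_pow d_def)
    finally show ?thesis using rel by (metis int_pow_one)
  qed
  define A' where "A' = {y \<in> A \<inter> greedy_basis R p. y [^] d y \<noteq> \<one>}"
  have trivial: "y [^] d y = \<one>" if y: "y \<in> A - A'" for y
  proof (cases "y \<in> greedy_basis R p")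
    case True
    then show ?thesis using y by (auto simp: A'_def)
  next
    case False
    obtain q where q: "Factorial_Ring.prime q" "y \<in> greedy_basis R q" using y A by blast
    then have qp: "q \<noteq> p" using False by auto
    obtain k where k: "ord y = q ^ k" using q greedy_basis_subset[of R q] unfolding p_elements_def by blast
    have yc: "y \<in> carrier G" using y Ac by auto
    have "q ^ k dvd p ^ n * N'" using ord_dvd_N[OF yc] k Nn by simp
    moreover have "coprime (q ^ k) (p ^ n)" using primes_coprime[OF q(1) p qp] by simp
    ultimately have "q ^ k dvd N'" using coprime_dvd_mult_right_iff by blast
    then have "q ^ k dvd N' * p ^ t'" by (rule dvd_mult2)
    then have "int (q ^ k) dvd int (N' * p ^ t')" by (simp only: of_nat_dvd_iff)
    then have "int (ord y) dvd d y" unfolding d_def k by (rule dvd_mult)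
    then show ?thesis using int_pow_eq_id[OF yc] by simp
  qed
  have A'sub: "A' \<subseteq> A" "A' \<subseteq> greedy_basis R p" by (auto simp: A'_def)
  have rel': "finprod G (\<lambda>y. y [^] d y) A' = \<one>"
  proof -
    have "finprod G (\<lambda>y. y [^] d y) A' = finprod G (\<lambda>y. y [^] d y) A"
      using A A'sub trivial Ac by (intro finprod_mono_neutral_cong_left) auto
    then show ?thesis using rel_d by simp
  qed
  have ex: "\<exists>g. y [^] d y = socle_power p y [^] g \<and> \<not> int p dvd g" if y: "y \<in> A'" for y
  proof -
    have yc: "y \<in> carrier G" using y A'sub Ac by auto
    obtain k where "ord y = p ^ k" "k \<ge> 1"
      using y A'sub greedy_basis_subset[of R p] unfolding p_elements_def by blast
    then obtain j where k: "ord y = p ^ Suc j" by (metis One_nat_def Suc_le_D)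
    have odp: "ord y div p = p ^ j" using k p by (simp add: prime_gt_0_nat)
    have "y [^] (c y * int (N' * p ^ t)) = \<one>" using Pt y A'sub by (auto simp: P_def)
    then have "int (ord y) dvd c y * int (N' * p ^ t)" using int_pow_eq_id[OF yc] by simp
    moreover have "c y * int (N' * p ^ t) = d y * int p" by (simp add: d_def t')
    moreover have "int (ord y) = int (p ^ j) * int p" using k by simp
    ultimately have "int (p ^ j) * int p dvd d y * int p" by metis
    then have "int (p ^ j) dvd d y" using p by (simp add: prime_gt_0_nat del: of_nat_power)
    then obtain g where g: "d y = int (p ^ j) * g" by blast
    have "y [^] d y = socle_power p y [^] g"
      unfolding g socle_power_def odp using yc by (simp add: int_pow_pow flip: int_pow_int)
    moreover have "\<not> int p dvd g"
    proof
      assume "int p dvd g"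
      then have "int (ord y) dvd d y" unfolding g k by auto
      then show False using y int_pow_eq_id[OF yc] by (simp add: A'_def)
    qed
    ultimately show ?thesis by blast
  qed
  then obtain g where g: "\<And>y. y \<in> A' \<Longrightarrow> y [^] d y = socle_power p y [^] g y"
     "\<And>y. y \<in> A' \<Longrightarrow> \<not> int p dvd g y" by metis
  have "finprod G (\<lambda>y. socle_power p y [^] g y) A' = \<one>"
  proof -
    have "finprod G (\<lambda>y. socle_power p y [^] g y) A' = finprod G (\<lambda>y. y [^] d y) A'"
      using g A'sub Ac by (intro finprod_cong') auto
    then show ?thesis using rel' by simp
  qed
  moreover have "A' \<noteq> {}" using nP by (auto simp: P_def A'_def d_def)
  moreover have "finite A'" using A A'sub finite_subset by blast
  ultimately show False using greedy_basis_no_relation[OF p] A'sub g(2) by blast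
qed

end

theorem prime_power_basis:
  "\<exists>B \<subseteq> carrier G. generate G B = carrier G \<and>
     (\<forall>y\<in>B. \<exists>p k. Factorial_Ring.prime p \<and> 1 \<le> k \<and> ord y = p ^ k) \<and>
     (\<forall>A (c :: 'a \<Rightarrow> int). finite A \<and> A \<subseteq> B \<and> finprod G (\<lambda>y. y [^] c y) A = \<one> \<longrightarrow>
        (\<forall>y\<in>A. y [^] c y = \<one>))"
proof -
  obtain R :: "'a rel" where R: "wf R" "trans R"
    "\<And>x y. \<lbrakk>x \<in> carrier G; y \<in> carrier G; x \<noteq> y\<rbrakk> \<Longrightarrow> (x, y) \<in> R \<or> (y, x) \<in> R"
    "\<And>x y. (x, y) \<in> R \<Longrightarrow> ord y \<le> ord x"
    using decreasing_order_well_ordering by blast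
  let ?B = "\<Union>p\<in>Collect Factorial_Ring.prime. greedy_basis R p"
  have 1: "?B \<subseteq> carrier G" using greedy_basis_subset p_elements_carrier by blast
  moreover have "generate G ?B = carrier G"
    using carrier_generated[OF R] generate_in_carrier[OF 1] by blast
  moreover have "\<forall>y\<in>?B. \<exists>p k. Factorial_Ring.prime p \<and> 1 \<le> k \<and> ord y = p ^ k"
    using greedy_basis_subset unfolding p_elements_def by blast
  ultimately show ?thesis using basis_independent[OF R] by (intro exI[of _ ?B]) blast
qed

end

abbreviation cyclic_index :: "nat set \<Rightarrow> (nat \<Rightarrow> nat) \<Rightarrow> (nat \<Rightarrow> nat \<Rightarrow> 'a set) \<Rightarrow> (nat \<times> nat \<times> 'a) set" where
  "cyclic_index M n K \<equiv> {(p, i, x). p \<in> M \<and> 1 \<le> i \<and> i \<le> n p \<and> x \<in> K p i}"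

context bounded_comm_group
begin

text \<open>
  An independent generating family exhibits the group as the direct sum of the cyclic subgroups that it generates.
  The family is indexed rather than a set, in order to match the index triples of \<open>cyclic_decomposition\<close>.
\<close>
lemma iso_sum_of_cyclic:
  assumes pr: "\<And>t. t \<in> I \<Longrightarrow> ord (b t) = m t"
    and inj: "inj_on b I" and bc: "b ` I \<subseteq> carrier G" and gen: "generate G (b ` I) = carrier G"
    and ind: "\<And>A c y. \<lbrakk>finite A; A \<subseteq> b ` I; finprod G (\<lambda>y. y [^] (c y :: int)) A = \<one>; y \<in> A\<rbrakk> \<Longrightarrow> y [^] c y = \<one>"
  shows "G \<cong> sum_group I (\<lambda>t. integer_mod_group (m t))"
proof -
  let ?Z = "\<lambda>t. integer_mod_group (m t)"
  let ?S = "sum_group I ?Z"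
  define \<phi> where "\<phi> = (\<lambda>f. gfinprod G (\<lambda>t. b t [^] (f t :: int)) I)"
  have bI: "b t \<in> carrier G" if "t \<in> I" for t using that bc by auto
  have m0: "m t > 0" if "t \<in> I" for t using pr[OF that] ord_pos[OF bI[OF that]] by simp
  have hom1: "(\<lambda>n::int. b t [^] n) \<in> hom (?Z t) G" if t: "t \<in> I" for t
  proof (rule homI)
    fix x y :: int
    have "int (m t) dvd (x + y) - (x + y) mod int (m t)" by (simp add: dvd_minus_mod)
    then have "b t [^] ((x + y) mod int (m t)) = b t [^] (x + y)"
      using bI[OF t] int_pow_eq pr[OF t] by simp
    then show "b t [^] (x \<otimes>\<^bsub>?Z t\<^esub> y) = b t [^] x \<otimes> b t [^] y"
      using bI[OF t] by (simp add: int_pow_mult)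
  qed (use bI t in auto)
  have "(\<lambda>f. gfinprod G (\<lambda>t. (\<lambda>n::int. b t [^] n) (f t)) I) \<in> hom ?S G"
    by (intro hom_group_sum hom1) auto
  then have hom: "\<phi> \<in> hom ?S G" by (simp add: \<phi>_def)
  have grpS: "group ?S" by simp
  interpret \<phi>: group_hom ?S G \<phi>
    using hom grpS is_group by (simp add: group_hom_def group_hom_axioms_def)
  have "inj_on \<phi> (carrier ?S)"
  proof (rule iffD2[OF \<phi>.inj_on_one_iff], intro allI impI)
    fix f assume f: "f \<in> carrier ?S" and f1: "\<phi> f = \<one>"
    let ?J = "{t \<in> I. f t \<noteq> 0}"
    have finJ: "finite ?J" and fext: "f \<in> extensional I"
      and frange: "\<And>t. t \<in> I \<Longrightarrow> f t \<in> {0..<int (m t)}"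
      using f m0 by (auto simp: carrier_sum_group carrier_integer_mod_group PiE_iff split: if_splits)
    define c where "c = (\<lambda>y. f (inv_into I b y))"
    have cb: "c (b t) = f t" if "t \<in> I" for t using that inj by (simp add: c_def)
    have "\<phi> f = gfinprod G (\<lambda>t. b t [^] f t) ?J"
      unfolding \<phi>_def using bI by (intro gfinprod_mono_neutral_cong_right) auto
    also have "\<dots> = finprod G (\<lambda>t. b t [^] f t) ?J"
      using finJ bI by (intro gfinprod_eq_finprod) auto
    also have "\<dots> = finprod G (\<lambda>t. b t [^] c (b t)) ?J"
      using bI cb by (intro finprod_cong') auto
    also have "\<dots> = finprod G (\<lambda>y. y [^] c y) (b ` ?J)"
      using bI inj by (intro finprod_reindex[symmetric]) (auto intro: inj_on_subset)
    finally have "finprod G (\<lambda>y. y [^] c y) (b ` ?J) = \<one>" using f1 by simp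
    then have rel: "y [^] c y = \<one>" if "y \<in> b ` ?J" for y
      using ind[of "b ` ?J" c y] finJ that by blast
    have "f t = 0" if t: "t \<in> I" for t
    proof (rule ccontr)
      assume ne: "f t \<noteq> 0"
      then have "b t [^] f t = \<one>" using rel[of "b t"] cb t by auto
      then have "int (m t) dvd f t" using int_pow_eq_id[OF bI[OF t]] pr[OF t] by simp
      then show False using frange[OF t] ne zdvd_imp_le by fastforce
    qed
    then show "f = \<one>\<^bsub>?S\<^esub>" using fext by (auto simp: extensional_def restrict_def)
  qed
  moreover have "\<phi> ` carrier ?S = carrier G"
  proof
    show "\<phi> ` carrier ?S \<subseteq> carrier G" using \<phi>.hom_closed by auto
    have "b ` I \<subseteq> \<phi> ` carrier ?S"
    proof clarify
      fix t assume t: "t \<in> I"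
      let ?f = "\<lambda>s\<in>I. if s = t then 1 mod int (m t) else 0"
      have "{s \<in> I. ?f s \<noteq> 0} \<subseteq> {t}" by auto
      then have "finite {s \<in> I. ?f s \<noteq> 0}" using finite_subset by blast
      then have fS: "?f \<in> carrier ?S"
        using m0 t by (auto simp: carrier_sum_group carrier_integer_mod_group)
      have "\<phi> ?f = gfinprod G (\<lambda>s. b s [^] ?f s) {t}"
        unfolding \<phi>_def using bI t by (intro gfinprod_mono_neutral_cong_right) auto
      also have "\<dots> = b t [^] (1 mod int (m t))" using t bI by (subst gfinprod_eq_finprod) auto
      also have "\<dots> = b t"
      proof -
        have "int (m t) dvd 1 - 1 mod int (m t)" by (simp add: dvd_minus_mod)
        then have "b t [^] (1 mod int (m t)) = b t [^] (1::int)"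
          by (simp only: int_pow_eq[OF bI[OF t]] pr[OF t])
        then show ?thesis using bI[OF t] by simp
      qed
      finally show "b t \<in> \<phi> ` carrier ?S" using fS by (metis imageI)
    qed
    then have "generate G (b ` I) \<subseteq> \<phi> ` carrier ?S"
      using \<phi>.img_is_subgroup generate_subgroup_incl by blast
    then show "carrier G \<subseteq> \<phi> ` carrier ?S" using gen by simp
  qed
  ultimately have "\<phi> \<in> iso ?S G" using hom by (simp add: iso_def bij_betw_def)
  then have "?S \<cong> G" unfolding is_iso_def by blast
  then show ?thesis using grpS group.iso_sym by blast
qed

text \<open>
  The index set \<open>K p i\<close> consists of the basis elements of order \<open>p\<^sup>i\<close>. Only primes and exponents that occur as such orders
  enter \<open>M\<close> and \<open>n\<close>, which makes each \<open>K p (n p)\<close> nonempty.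
\<close>
theorem cyclic_decomposition_exists: "\<exists>M n K. cyclic_decomposition G M n K"
proof -
  from prime_power_basis obtain B where B: "B \<subseteq> carrier G" "generate G B = carrier G"
    and pp: "\<forall>y\<in>B. \<exists>p k. Factorial_Ring.prime p \<and> 1 \<le> k \<and> ord y = p ^ k"
    and ind: "\<forall>A (c :: 'a \<Rightarrow> int). finite A \<and> A \<subseteq> B \<and> finprod G (\<lambda>y. y [^] c y) A = \<one> \<longrightarrow>
        (\<forall>y\<in>A. y [^] c y = \<one>)"
    by (elim exE conjE) (rule that)
  define K where "K = (\<lambda>p i. {y \<in> B. ord y = p ^ i})"
  define M where "M = {p. Factorial_Ring.prime p \<and> (\<exists>i\<ge>1. K p i \<noteq> {})}"
  define E where "E = (\<lambda>p. {i. 1 \<le> i \<and> K p i \<noteq> {}})"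
  define n where "n = (\<lambda>p. Max (E p))"
  have M_dvd: "p dvd N" if p: "p \<in> M" for p
  proof -
    obtain y i where "y \<in> B" "ord y = p ^ i" "i \<ge> 1" using p unfolding M_def K_def by blast
    then show ?thesis using ord_dvd_N[of y] B by (metis dvd_power dvd_trans gr0I not_one_le_zero subsetD)
  qed
  have "finite M"
    using M_dvd N_pos by (intro finite_subset[OF _ finite_divisors_nat[of N]]) auto
  have finE: "finite (E p)" if p: "p \<in> M" for p
  proof -
    have "i \<le> N" if i: "i \<in> E p" for i
    proof -
      obtain y where y: "y \<in> B" "ord y = p ^ i" using i unfolding E_def K_def by blast
      then have "p ^ i \<le> N" using ord_le_N B by (metis subsetD)
      moreover have "1 < p" using p prime_gt_1_nat by (auto simp: M_def)
      then have "i < p ^ i" by (simp add: power_gt_expt)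
      ultimately show ?thesis by simp
    qed
    then show ?thesis using finite_nat_set_iff_bounded_le by blast
  qed
  have neE: "E p \<noteq> {}" if "p \<in> M" for p using that by (auto simp: M_def E_def)
  have nE: "n p \<in> E p" if "p \<in> M" for p using Max_in[OF finE[OF that] neE[OF that]] by (simp add: n_def)
  let ?I = "cyclic_index M n K"
  let ?b = "\<lambda>(p::nat, i::nat, x::'a). x"
  have bI: "?b ` ?I = B"
  proof
    show "?b ` ?I \<subseteq> B" by (auto simp: K_def)
    show "B \<subseteq> ?b ` ?I"
    proof
      fix y assume y: "y \<in> B"
      obtain p i where pi: "Factorial_Ring.prime p" "1 \<le> i" "ord y = p ^ i" using pp y by blast
      then have yK: "y \<in> K p i" using y by (simp add: K_def)
      then have pM: "p \<in> M" using pi by (auto simp: M_def)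
      have "i \<in> E p" using yK pi by (auto simp: E_def)
      then have "i \<le> n p" using finE[OF pM] by (simp add: n_def)
      then have "(p, i, y) \<in> ?I" using pM pi yK by simp
      then show "y \<in> ?b ` ?I" by force
    qed
  qed
  have inj: "inj_on ?b ?I"
  proof (rule inj_onI)
    fix s t assume st: "s \<in> ?I" "t \<in> ?I" "?b s = ?b t"
    obtain p i x q j where eq: "s = (p, i, x)" "t = (q, j, x)"
      using st(3) by (cases s; cases t) auto
    have "p ^ i = q ^ j" "Factorial_Ring.prime p" "Factorial_Ring.prime q" "0 < i" "0 < j"
      using st(1,2) by (auto simp: eq K_def M_def)
    then have "p = q \<and> i = j" using prime_power_inj'[of p q i j] by simp
    then show "s = t" by (simp add: eq)
  qed
  have "G \<cong> sum_group ?I (\<lambda>t. integer_mod_group ((\<lambda>(p, i, x). p ^ i) t))"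
  proof (rule iso_sum_of_cyclic[where b = ?b])
    show "ord (?b t) = (\<lambda>(p, i, x). p ^ i) t" if "t \<in> ?I" for t
      using that by (auto simp: K_def)
    show "inj_on ?b ?I" by (rule inj)
    show "?b ` ?I \<subseteq> carrier G" using B bI by simp
    show "generate G (?b ` ?I) = carrier G" using B bI by simp
    show "y [^] c y = \<one>" if "finite A" "A \<subseteq> ?b ` ?I" "finprod G (\<lambda>y. y [^] (c y :: int)) A = \<one>" "y \<in> A" for A c y
      using ind that unfolding bI by blast
  qed
  moreover have "(\<lambda>t. integer_mod_group ((\<lambda>(p, i, x::'a). p ^ i) t)) = (\<lambda>(p, i, x). integer_mod_group (p ^ i))"
    by (auto simp: fun_eq_iff)
  ultimately have "G \<cong> sum_group ?I (\<lambda>(p, i, x). integer_mod_group (p ^ i))" by simp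
  moreover have "\<forall>p\<in>M. Factorial_Ring.prime p \<and> 1 \<le> n p \<and> K p (n p) \<noteq> {}"
    using nE by (auto simp: M_def E_def)
  ultimately have "cyclic_decomposition G M n K"
    using \<open>finite M\<close> by (simp add: cyclic_decomposition_def)
  then show ?thesis by blast
qed

end

section \<open>Characters and coordinates\<close>

lemma comm_group_circle_group: "comm_group circle_group"
proof (rule comm_groupI)
  show "\<exists>y\<in>carrier circle_group. y \<otimes>\<^bsub>circle_group\<^esub> x = \<one>\<^bsub>circle_group\<^esub>"
    if "x \<in> carrier circle_group" for x
  proof (rule bexI[of _ "inverse x"])
    have "x \<noteq> 0" using that by (auto simp: circle_group_def)
    then show "inverse x \<otimes>\<^bsub>circle_group\<^esub> x = \<one>\<^bsub>circle_group\<^esub>" by (simp add: circle_group_def)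
  qed (use that in \<open>auto simp: circle_group_def norm_inverse\<close>)
qed (auto simp: circle_group_def norm_mult)

lemma circle_group_simps [simp]:
  "carrier circle_group = sphere 0 1" "x \<otimes>\<^bsub>circle_group\<^esub> y = x * y" "\<one>\<^bsub>circle_group\<^esub> = 1"
  by (auto simp: circle_group_def)

context group
begin

abbreviation character :: "('a \<Rightarrow> complex) \<Rightarrow> bool" where
  "character h \<equiv> h \<in> hom G circle_group"

lemma character_mult: "\<lbrakk>character h; x \<in> carrier G; y \<in> carrier G\<rbrakk> \<Longrightarrow> h (x \<otimes> y) = h x * h y"
  by (auto simp: hom_def)

lemma character_norm: "\<lbrakk>character h; x \<in> carrier G\<rbrakk> \<Longrightarrow> norm (h x) = 1"
  by (auto simp: hom_def)

lemma character_one [simp]: "character h \<Longrightarrow> h \<one> = 1"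
  using hom_one[of h G circle_group] comm_group_circle_group is_group
  by (simp add: comm_group_def)

lemma character_nat_pow: "\<lbrakk>character h; x \<in> carrier G\<rbrakk> \<Longrightarrow> h (x [^] (k::nat)) = h x ^ k"
  by (induction k) (auto simp: character_mult)

lemma character_inv: "\<lbrakk>character h; x \<in> carrier G\<rbrakk> \<Longrightarrow> h (inv x) = inverse (h x)"
proof -
  assume "character h" "x \<in> carrier G"
  then have "h x * h (inv x) = 1" using character_mult[of h x "inv x"] by (simp add: r_inv)
  then show ?thesis by (simp add: inverse_unique)
qed

end

text \<open>
  All that is used of the isomorphism: the characters \<open>\<xi> t\<close> that read off a coordinate as a root of unity, and
  the generators \<open>g t\<close> of the summands. Expressed in this way, the decomposition can be
  used without mentioning the isomorphism or the extensional functions that form the sum.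
\<close>
lemma cyclic_decomposition_coordinates:
  fixes G :: "('a, 'b) monoid_scheme" (structure)
  assumes "group G" and dec: "cyclic_decomposition G M n K"
  obtains \<xi> g where
    "\<And>t. t \<in> cyclic_index M n K \<Longrightarrow> \<xi> t \<in> hom G circle_group"
    "\<And>t. t \<in> cyclic_index M n K \<Longrightarrow> g t \<in> carrier G"
    "\<And>p i x y. \<lbrakk>(p, i, x) \<in> cyclic_index M n K; y \<in> carrier G\<rbrakk> \<Longrightarrow> \<xi> (p, i, x) y ^ (p ^ i) = 1"
    "\<And>y. y \<in> carrier G \<Longrightarrow> finite {t \<in> cyclic_index M n K. \<xi> t y \<noteq> 1}"
    "\<And>y. \<lbrakk>y \<in> carrier G; \<forall>t\<in>cyclic_index M n K. \<xi> t y = 1\<rbrakk> \<Longrightarrow> y = \<one>"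
    "\<And>p i x. (p, i, x) \<in> cyclic_index M n K \<Longrightarrow> \<xi> (p, i, x) (g (p, i, x)) = cis (2 * pi / real (p ^ i))"
    "\<And>s t. \<lbrakk>s \<in> cyclic_index M n K; t \<in> cyclic_index M n K; s \<noteq> t\<rbrakk> \<Longrightarrow> \<xi> s (g t) = 1"
proof -
  interpret group G by fact
  define I where "I = cyclic_index M n K"
  define m where "m = (\<lambda>(p::nat, i::nat, x::'a). p ^ i)"
  let ?Z = "\<lambda>t. integer_mod_group (m t)"
  let ?S = "sum_group I ?Z"
  have eq: "(\<lambda>(p, i, x::'a). integer_mod_group (p ^ i)) = ?Z" by (auto simp: fun_eq_iff m_def)
  have pr: "Factorial_Ring.prime p" if "p \<in> M" for p
    using dec that by (auto simp: cyclic_decomposition_def)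
  have m0: "m t > 1" if tI: "t \<in> I" for t
  proof -
    obtain p i x where t: "t = (p, i, x)" "p \<in> M" "1 \<le> i" using tI by (auto simp: I_def)
    then have "1 < p" using pr prime_gt_1_nat by blast
    then show ?thesis using t one_less_power[of p i] by (simp add: m_def)
  qed
  have "G \<cong> ?S" using dec unfolding cyclic_decomposition_def eq I_def by blast
  then obtain \<psi> where \<psi>: "\<psi> \<in> iso G ?S" unfolding is_iso_def by blast
  have grpS: "group ?S" by simp
  have \<psi>hom: "\<psi> \<in> hom G ?S" and \<psi>bij: "bij_betw \<psi> (carrier G) (carrier ?S)"
    using \<psi> by (auto simp: iso_def)
  have \<psi>c: "\<psi> y \<in> carrier ?S" if "y \<in> carrier G" for y using \<psi>hom that by (auto simp: hom_def)
  have \<psi>r: "\<psi> y t \<in> {0..<int (m t)}" if "y \<in> carrier G" "t \<in> I" for y t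
    using \<psi>c[OF that(1)] that(2) m0[OF that(2)]
    by (auto simp: carrier_sum_group carrier_integer_mod_group PiE_iff split: if_splits)
  define \<xi> where "\<xi> = (\<lambda>t y. cis (2 * pi * real_of_int (\<psi> y t) / real (m t)))"
  have cis_mod: "cis (2 * pi * real_of_int (k mod int q) / real q) = cis (2 * pi * real_of_int k / real q)"
    if "q > 0" for k q
  proof -
    have "real_of_int k = real_of_int (k mod int q) + real q * real_of_int (k div int q)"
      by (metis add.commute mult_div_mod_eq of_int_add of_int_mult of_int_of_nat_eq)
    then have "2 * pi * real_of_int k / real q
      = 2 * pi * real_of_int (k mod int q) / real q + 2 * pi * real_of_int (k div int q)"
      using that by (simp add: field_simps)
    moreover have "cis (2 * pi * real_of_int (k div int q)) = 1" by (simp add: cis_multiple_2pi)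
    ultimately show ?thesis by (simp flip: cis_mult)
  qed
  have cis1: "cis (2 * pi * real_of_int k / real q) = 1 \<longleftrightarrow> k = 0" if "k \<in> {0..<int q}" "q > 0" for k q
  proof
    assume "cis (2 * pi * real_of_int k / real q) = 1"
    then have "cos (2 * pi * real_of_int k / real q) = 1" by (metis Re_complex_of_real cis.simps(1) one_complex.simps(1))
    then obtain j :: int where "2 * pi * real_of_int k / real q = real_of_int j * 2 * pi"
      using cos_one_2pi_int by auto
    then have "real_of_int k = real_of_int j * real q" using that by (simp add: field_simps)
    then have "k = j * int q" by (metis of_int_eq_iff of_int_mult of_int_of_nat_eq)
    then show "k = 0" using that by (metis atLeastLessThan_iff dvd_triv_right zdvd_not_zless not_less le_less)
  qed simp
  have \<xi>hom: "\<xi> t \<in> hom G circle_group" if t: "t \<in> I" for t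
  proof (rule homI)
    fix x y assume xy: "x \<in> carrier G" "y \<in> carrier G"
    have "\<psi> (x \<otimes> y) = \<psi> x \<otimes>\<^bsub>?S\<^esub> \<psi> y" using \<psi>hom xy by (auto simp: hom_def)
    then have "\<psi> (x \<otimes> y) t = (\<psi> x t + \<psi> y t) mod int (m t)" using t by simp
    then have "\<xi> t (x \<otimes> y) = cis (2 * pi * real_of_int (\<psi> x t + \<psi> y t) / real (m t))"
      unfolding \<xi>_def using cis_mod m0[OF t] by simp
    then show "\<xi> t (x \<otimes> y) = \<xi> t x \<otimes>\<^bsub>circle_group\<^esub> \<xi> t y"
      by (simp add: \<xi>_def cis_mult add_divide_distrib distrib_left)
  qed (auto simp: \<xi>_def)
  define g where "g = (\<lambda>t. inv_into (carrier G) \<psi> (\<lambda>s\<in>I. if s = t then 1 else 0))"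
  have gS: "(\<lambda>s\<in>I. if s = t then 1 else 0::int) \<in> carrier ?S" if t: "t \<in> I" for t
  proof -
    have "{s \<in> I. (\<lambda>s\<in>I. if s = t then 1 else 0::int) s \<noteq> 0} \<subseteq> {t}" by auto
    then have "finite {s \<in> I. (\<lambda>s\<in>I. if s = t then 1 else 0::int) s \<noteq> 0}" using finite_subset by blast
    moreover have "1 < m t" using m0 t by blast
    moreover have "0 < m s" if "s \<in> I" for s using m0[OF that] by simp
    ultimately show ?thesis by (auto simp: carrier_sum_group carrier_integer_mod_group)
  qed
  have gc: "g t \<in> carrier G" and \<psi>g: "\<psi> (g t) = (\<lambda>s\<in>I. if s = t then 1 else 0)" if "t \<in> I" for t
    using gS[OF that] \<psi>bij by (auto simp: g_def bij_betw_def inv_into_into f_inv_into_f)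
  have fin: "finite {t \<in> I. \<xi> t y \<noteq> 1}" if "y \<in> carrier G" for y
  proof -
    have "finite {t \<in> I. \<psi> y t \<noteq> 0}" using \<psi>c[OF that] by (auto simp: carrier_sum_group)
    then show ?thesis by (rule rev_finite_subset) (auto simp: \<xi>_def)
  qed
  have root: "\<xi> t y ^ m t = 1" if "t \<in> I" "y \<in> carrier G" for t y
  proof -
    have "real (m t) * (2 * pi * real_of_int (\<psi> y t) / real (m t)) = 2 * pi * real_of_int (\<psi> y t)"
      using m0[OF that(1)] by simp
    then show ?thesis unfolding \<xi>_def Complex.DeMoivre using cis_multiple_2pi[OF Ints_of_int] by (simp only:)
  qed
  have sep: "y = \<one>" if y: "y \<in> carrier G" and 1: "\<And>t. t \<in> I \<Longrightarrow> \<xi> t y = 1" for y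
  proof -
    have "\<psi> y t = 0" if "t \<in> I" for t
      using 1[OF that] \<psi>r[OF y that] cis1[of "\<psi> y t" "m t"] m0[OF that] by (simp add: \<xi>_def)
    moreover have "\<psi> y \<in> extensional I" using \<psi>c[OF y] by (auto simp: carrier_sum_group PiE_iff)
    ultimately have "\<psi> y = \<one>\<^bsub>?S\<^esub>" by (auto simp: extensional_def restrict_def)
    moreover have "\<psi> \<one> = \<one>\<^bsub>?S\<^esub>" using hom_one[OF \<psi>hom is_group grpS] .
    ultimately show ?thesis using \<psi>bij y by (metis bij_betw_def inj_onD one_closed)
  qed
  show thesis
  proof (rule that[of \<xi> g], unfold I_def[symmetric])
    show "\<xi> t \<in> hom G circle_group" if "t \<in> I" for t by (rule \<xi>hom[OF that])
    show "g t \<in> carrier G" if "t \<in> I" for t by (rule gc[OF that])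
    show "\<xi> (p, i, x) y ^ (p ^ i) = 1" if "(p, i, x) \<in> I" "y \<in> carrier G" for p i x y
      using root[OF that] by (simp add: m_def)
    show "finite {t \<in> I. \<xi> t y \<noteq> 1}" if "y \<in> carrier G" for y by (rule fin[OF that])
    show "y = \<one>" if "y \<in> carrier G" "\<forall>t\<in>I. \<xi> t y = 1" for y using sep that by blast
    show "\<xi> (p, i, x) (g (p, i, x)) = cis (2 * pi / real (p ^ i))" if "(p, i, x) \<in> I" for p i x
      using \<psi>g[OF that] that by (simp add: \<xi>_def m_def)
    show "\<xi> s (g t) = 1" if "s \<in> I" "t \<in> I" "s \<noteq> t" for s t
      using \<psi>g[OF that(2)] that by (simp add: \<xi>_def)
  qed
qed

section \<open>A finite leading invariant bounds the radical\<close>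

lemma cis_root_power_eq_1:
  assumes "q > 0" "cis (2 * pi / real q) ^ k = 1"
  shows "q dvd k"
proof -
  have "cos (real k * (2 * pi / real q)) = 1"
    using assms(2) unfolding Complex.DeMoivre by (metis cis.simps(1) one_complex.simps(1))
  then obtain j :: int where "real k * (2 * pi / real q) = real_of_int j * 2 * pi"
    using cos_one_2pi_int by auto
  then have "real k * (2 * pi) = real_of_int j * real q * (2 * pi)" using assms(1) by (simp add: field_simps)
  then have "real k = real_of_int j * real q" by simp
  then have "int k = j * int q" by (metis of_int_eq_iff of_int_mult of_int_of_nat_eq)
  then show ?thesis by (metis dvd_triv_right of_nat_dvd_iff)
qed

lemma group_topology_nat_pow:
  assumes "group G" "group_topology G T"
  shows "continuous_map T T (\<lambda>x. x [^]\<^bsub>G\<^esub> (k::nat))"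
proof (induction k)
  case 0
  have "\<one>\<^bsub>G\<^esub> \<in> topspace T" using assms by (simp add: group_topology_def group.is_monoid monoid.one_closed)
  then show ?case by simp
next
  case (Suc k)
  have "continuous_map T (prod_topology T T) (\<lambda>x. (x [^]\<^bsub>G\<^esub> k, x))"
    using Suc by (simp add: continuous_map_pairedI)
  moreover have "continuous_map (prod_topology T T) T (\<lambda>(x, y). x \<otimes>\<^bsub>G\<^esub> y)"
    using assms by (simp add: group_topology_def)
  ultimately have "continuous_map T T ((\<lambda>(x, y). x \<otimes>\<^bsub>G\<^esub> y) \<circ> (\<lambda>x. (x [^]\<^bsub>G\<^esub> k, x)))"
    by (rule continuous_map_compose)
  then show ?case by (simp add: o_def)
qed

lemma group_topology_translation:
  assumes "group_topology G T" "a \<in> carrier G"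
  shows "continuous_map T T (\<lambda>x. a \<otimes>\<^bsub>G\<^esub> x)"
proof -
  have "continuous_map T (prod_topology T T) (\<lambda>x. (a, x))"
    using assms by (simp add: continuous_map_pairedI group_topology_def)
  moreover have "continuous_map (prod_topology T T) T (\<lambda>(x, y). x \<otimes>\<^bsub>G\<^esub> y)"
    using assms by (simp add: group_topology_def)
  ultimately have "continuous_map T T ((\<lambda>(x, y). x \<otimes>\<^bsub>G\<^esub> y) \<circ> (\<lambda>x. (a, x)))"
    by (rule continuous_map_compose)
  then show ?thesis by (simp add: o_def)
qed

context group
begin

lemma character_trivial_on_open_continuous:
  assumes T: "group_topology G T" and V: "openin T V" "\<one> \<in> V"
    and h: "character h" and hV: "\<And>v. v \<in> V \<Longrightarrow> h v = 1"
  shows "h \<in> continuous_characters G T"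
proof -
  have top: "topspace T = carrier G" using T by (simp add: group_topology_def)
  have "continuous_map T (top_of_set (sphere 0 1)) h"
    unfolding continuous_map
  proof (intro conjI allI impI)
    show "h ` topspace T \<subseteq> topspace (top_of_set (sphere 0 1))"
      using h top by (auto simp: hom_def)
    fix U assume "openin (top_of_set (sphere (0::complex) 1)) U"
    show "openin T {x \<in> topspace T. h x \<in> U}"
    proof (subst openin_subopen, intro ballI)
      fix x assume "x \<in> {x \<in> topspace T. h x \<in> U}"
      then have x: "x \<in> carrier G" "h x \<in> U" using top by auto
      let ?W = "{y \<in> topspace T. inv x \<otimes> y \<in> V}"
      have "openin T ?W"
        using openin_continuous_map_preimage[OF group_topology_translation[OF T inv_closed[OF x(1)]] V(1)] .
      moreover have "x \<in> ?W" using x V(2) top by (simp add: l_inv)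
      moreover have "?W \<subseteq> {x \<in> topspace T. h x \<in> U}"
      proof
        fix y assume y: "y \<in> ?W"
        then have yc: "y \<in> carrier G" using top by simp
        have "h y = h (x \<otimes> (inv x \<otimes> y))" using x(1) yc by (simp add: m_assoc[symmetric] r_inv)
        also have "\<dots> = h x * h (inv x \<otimes> y)" using x(1) yc h by (simp add: character_mult)
        also have "\<dots> = h x" using hV y by simp
        finally show "y \<in> {x \<in> topspace T. h x \<in> U}" using x yc top by simp
      qed
      ultimately show "\<exists>W. openin T W \<and> x \<in> W \<and> W \<subseteq> {x \<in> topspace T. h x \<in> U}" by blast
    qed
  qed
  then show ?thesis using h by (simp add: continuous_characters_def)
qed

text \<open>
  The elements whose \<open>m\<close>-th power is trivial form an open subgroup, because they are the
  preimage of the complement of a finite, hence closed, set.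
\<close>
lemma finite_power_image_continuous:
  assumes T: "group_topology G T" "Hausdorff_space T"
    and fin: "finite ((\<lambda>x. x [^] (m::nat)) ` carrier G)"
    and h: "character h" and triv: "\<And>v. \<lbrakk>v \<in> carrier G; v [^] m = \<one>\<rbrakk> \<Longrightarrow> h v = 1"
  shows "h \<in> continuous_characters G T"
proof -
  have top: "topspace T = carrier G" using T by (simp add: group_topology_def)
  let ?Y = "(\<lambda>x. x [^] m) ` carrier G"
  have "closedin T (?Y - {\<one>})"
    using T(2) fin top by (intro closedin_Hausdorff_finite) auto
  then have op: "openin T (topspace T - (?Y - {\<one>}))" by blast
  let ?V = "{x \<in> topspace T. x [^] m \<in> topspace T - (?Y - {\<one>})}"
  have "openin T ?V"
    using openin_continuous_map_preimage[OF group_topology_nat_pow[OF is_group T(1)] op] .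
  moreover have "\<one> \<in> ?V" using top by simp
  moreover have "h v = 1" if "v \<in> ?V" for v using that triv top by auto
  ultimately show ?thesis using character_trivial_on_open_continuous[OF T(1) _ _ h] by blast
qed

end

lemma cyclic_decomposition_prime:
  "\<lbrakk>cyclic_decomposition G M n K; p \<in> M\<rbrakk> \<Longrightarrow> Factorial_Ring.prime p"
  by (simp add: cyclic_decomposition_def)

text \<open>
  With \<open>N\<close> the product of the \<open>q ^ n q\<close>, the exponent \<open>m\<close> below is \<open>N/p\<close>. The \<open>m\<close>-th powers have trivial coordinates outside
  the summands of order \<open>p ^ n p\<close>, so there are finitely many of them, while \<open>h\<close>, the \<open>m\<close>-th power of a coordinate
  character, differs from \<open>1\<close> on the generator of that coordinate.
\<close>
lemma finite_leading_invariant_imp_not_NR: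
  fixes G :: "('a, 'b) monoid_scheme" (structure)
  assumes "comm_group G" and dec: "cyclic_decomposition G M n K"
    and p: "p \<in> M" and fin: "finite (K p (n p))"
  shows "\<exists>H. subgroup H G \<and> countable H \<and> H \<notin> NR G"
proof -
  interpret comm_group G by fact
  obtain \<xi> g where \<xi>: "\<And>t. t \<in> cyclic_index M n K \<Longrightarrow> \<xi> t \<in> hom G circle_group"
    and g: "\<And>t. t \<in> cyclic_index M n K \<Longrightarrow> g t \<in> carrier G"
    and root: "\<And>p i x y. \<lbrakk>(p, i, x) \<in> cyclic_index M n K; y \<in> carrier G\<rbrakk> \<Longrightarrow> \<xi> (p, i, x) y ^ (p ^ i) = 1"
    and sep: "\<And>y. \<lbrakk>y \<in> carrier G; \<forall>t\<in>cyclic_index M n K. \<xi> t y = 1\<rbrakk> \<Longrightarrow> y = \<one>"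
    and gen: "\<And>p i x. (p, i, x) \<in> cyclic_index M n K \<Longrightarrow> \<xi> (p, i, x) (g (p, i, x)) = cis (2 * pi / real (p ^ i))"
    by (rule cyclic_decomposition_coordinates[OF is_group dec]) (rule that)
  let ?I = "cyclic_index M n K"
  have M: "finite M" and np: "1 \<le> n p" and Kp: "K p (n p) \<noteq> {}"
    using dec p by (auto simp: cyclic_decomposition_def)
  have pp: "Factorial_Ring.prime p" using cyclic_decomposition_prime[OF dec p] .
  define m where "m = p ^ (n p - 1) * (\<Prod>q\<in>M - {p}. q ^ n q)"
  have other: "\<xi> (q, i, x) (y [^] m) = 1"
    if t: "(q, i, x) \<in> ?I" and ne: "\<not> (q = p \<and> i = n p)" and y: "y \<in> carrier G" for q i x y
  proof -
    have "q ^ i dvd m"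
    proof (cases "q = p")
      case True
      then have "i \<le> n p - 1" using t ne by auto
      then show ?thesis unfolding m_def True by (simp add: le_imp_power_dvd dvd_mult2)
    next
      case False
      then have "q ^ n q dvd (\<Prod>q\<in>M - {p}. q ^ n q)" using M t by (intro dvd_prodI) auto
      moreover have "q ^ i dvd q ^ n q" using t by (simp add: le_imp_power_dvd)
      ultimately show ?thesis unfolding m_def by (meson dvd_mult dvd_trans)
    qed
    then obtain r where "m = q ^ i * r" by blast
    then have "\<xi> (q, i, x) y ^ m = 1" using root[OF t y] by (simp add: power_mult)
    then show ?thesis using \<xi>[OF t] y by (simp add: character_nat_pow)
  qed
  define T0 where "T0 = (\<lambda>x. (p, n p, x)) ` K p (n p)"
  have T0: "finite T0" "T0 \<subseteq> ?I" using fin p np by (auto simp: T0_def)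
  have power_fin: "finite ((\<lambda>y. y [^] m) ` carrier G)"
  proof (rule finite_imageD)
    let ?f = "\<lambda>y. \<lambda>t\<in>T0. \<xi> t y"
    show "inj_on ?f ((\<lambda>y. y [^] m) ` carrier G)"
    proof (rule inj_onI, elim imageE)
      fix a b y z assume a: "a = y [^] m" "y \<in> carrier G" and b: "b = z [^] m" "z \<in> carrier G"
        and eq: "?f a = ?f b"
      have c: "a \<in> carrier G" "b \<in> carrier G" using a b by auto
      have "\<xi> t (a \<otimes> inv b) = 1" if t: "t \<in> ?I" for t
      proof -
        have "\<xi> t a = \<xi> t b"
        proof (cases "t \<in> T0")
          case True
          then show ?thesis using fun_cong[OF eq, of t] by simp
        next
          case False
          obtain q i x where tt: "t = (q, i, x)" using prod_cases3 by blast
          then have "\<not> (q = p \<and> i = n p)" using False t by (auto simp: T0_def)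
          then show ?thesis using other t a b unfolding tt by simp
        qed
        moreover have "\<xi> t b \<noteq> 0" using character_norm[OF \<xi>[OF t] c(2)] by auto
        ultimately show ?thesis using \<xi>[OF t] c by (simp add: character_mult character_inv)
      qed
      then have "a \<otimes> inv b = \<one>" using sep[of "a \<otimes> inv b"] c by simp
      then show "a = b" using c by (metis inv_closed inv_equality inv_inv)
    qed
    have "?f ` ((\<lambda>y. y [^] m) ` carrier G) \<subseteq> PiE T0 (\<lambda>_. {z. z ^ (p ^ n p) = 1})"
      using root T0 by (auto simp: T0_def)
    moreover have "finite (PiE T0 (\<lambda>_. {z::complex. z ^ (p ^ n p) = 1}))"
      using T0(1) pp by (intro finite_PiE finite_roots_unity) (auto simp: Suc_le_eq prime_gt_0_nat)
    ultimately show "finite (?f ` ((\<lambda>y. y [^] m) ` carrier G))" by (rule finite_subset)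
  qed
  obtain x0 where x0: "x0 \<in> K p (n p)" using Kp by blast
  let ?t0 = "(p, n p, x0)"
  have t0: "?t0 \<in> ?I" using x0 p np by simp
  define h where "h = (\<lambda>y. \<xi> ?t0 y ^ m)"
  have h: "character h"
    using \<xi>[OF t0] by (auto simp: h_def hom_def power_mult_distrib norm_power Pi_iff)
  have hg: "h (g ?t0) \<noteq> 1"
  proof
    assume "h (g ?t0) = 1"
    then have "p ^ n p dvd m"
      using gen[OF t0] cis_root_power_eq_1[of "p ^ n p" m] pp by (simp add: h_def prime_gt_0_nat)
    moreover have "p ^ n p = p ^ (n p - 1) * p" using np by (metis Suc_diff_1 less_le_trans power_Suc2 zero_less_one)
    ultimately have "p dvd (\<Prod>q\<in>M - {p}. q ^ n q)" using pp by (simp add: m_def prime_gt_0_nat)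
    then obtain q where q: "q \<in> M - {p}" "p dvd q ^ n q"
      using prime_dvd_prod_iff[OF _ pp, of "M - {p}"] M by auto
    then have "p dvd q" using pp prime_dvd_power by blast
    then show False using q(1) pp cyclic_decomposition_prime[OF dec, of q] primes_dvd_imp_eq by auto
  qed
  let ?H = "generate G {g ?t0}"
  have "subgroup ?H G" using g[OF t0] by (intro generate_is_subgroup) simp
  moreover have "countable ?H"
    unfolding generate_pow[OF g[OF t0]] by (simp add: full_SetCompr_eq)
  moreover have "?H \<notin> NR G"
  proof
    assume "?H \<in> NR G"
    then obtain T where T: "group_topology G T" "Hausdorff_space T" "von_Neumann_radical G T = ?H"
      by (auto simp: NR_def)
    have "h v = 1" if "v \<in> carrier G" "v [^] m = \<one>" for v
      using that \<xi>[OF t0] character_nat_pow[OF \<xi>[OF t0] that(1), of m] by (simp add: h_def)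
    then have "h \<in> continuous_characters G T"
      using finite_power_image_continuous[OF T(1,2) power_fin h] by blast
    moreover have "g ?t0 \<in> von_Neumann_radical G T" unfolding T(3) by (auto intro: generate.incl)
    ultimately show False using hg by (auto simp: von_Neumann_radical_def kernel_def)
  qed
  ultimately show ?thesis by blast
qed


section \<open>Elements of maximal order independent of a finite subgroup\<close>

text \<open>
  The \<open>(N/p)\<close>-th powers of the generators of the infinitely many summands of order \<open>p ^ n p\<close> are told apart by
  their coordinates.
\<close>
lemma infinite_leading_invariants_imp_infinite_powers:
  fixes G :: "('a, 'b) monoid_scheme" (structure)
  assumes "comm_group G" and dec: "cyclic_decomposition G M n K"
    and inf: "\<And>p. p \<in> M \<Longrightarrow> infinite (K p (n p))"
  shows "\<exists>N. bounded_comm_group G N \<and>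
    (\<forall>p. Factorial_Ring.prime p \<and> p dvd N \<longrightarrow> infinite ((\<lambda>x. x [^] (N div p)) ` carrier G))"
proof -
  interpret comm_group G by fact
  obtain \<xi> g where \<xi>: "\<And>t. t \<in> cyclic_index M n K \<Longrightarrow> \<xi> t \<in> hom G circle_group"
    and g: "\<And>t. t \<in> cyclic_index M n K \<Longrightarrow> g t \<in> carrier G"
    and root: "\<And>p i x y. \<lbrakk>(p, i, x) \<in> cyclic_index M n K; y \<in> carrier G\<rbrakk> \<Longrightarrow> \<xi> (p, i, x) y ^ (p ^ i) = 1"
    and sep: "\<And>y. \<lbrakk>y \<in> carrier G; \<forall>t\<in>cyclic_index M n K. \<xi> t y = 1\<rbrakk> \<Longrightarrow> y = \<one>"
    and gen: "\<And>p i x. (p, i, x) \<in> cyclic_index M n K \<Longrightarrow> \<xi> (p, i, x) (g (p, i, x)) = cis (2 * pi / real (p ^ i))"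
    and orth: "\<And>s t. \<lbrakk>s \<in> cyclic_index M n K; t \<in> cyclic_index M n K; s \<noteq> t\<rbrakk> \<Longrightarrow> \<xi> s (g t) = 1"
    by (rule cyclic_decomposition_coordinates[OF is_group dec]) (rule that)
  let ?I = "cyclic_index M n K"
  have M: "finite M" and pr: "\<And>p. p \<in> M \<Longrightarrow> Factorial_Ring.prime p" and n1: "\<And>p. p \<in> M \<Longrightarrow> 1 \<le> n p"
    using dec by (auto simp: cyclic_decomposition_def)
  define N where "N = (\<Prod>q\<in>M. q ^ n q)"
  have N0: "N > 0" unfolding N_def using pr by (intro prod_pos) (auto simp: prime_gt_0_nat)
  have "x [^] N = \<one>" if x: "x \<in> carrier G" for x
  proof (rule sep, use x in simp, rule ballI)
    fix t assume t: "t \<in> ?I"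
    obtain q i y where tt: "t = (q, i, y)" using prod_cases3 by blast
    have qM: "q \<in> M" and iq: "i \<le> n q" using t tt by auto
    have "q ^ i dvd q ^ n q" using iq by (rule le_imp_power_dvd)
    also have "q ^ n q dvd N" unfolding N_def using M qM by (rule dvd_prodI)
    finally obtain r where r: "N = q ^ i * r" by blast
    have "\<xi> t x ^ N = 1" using root t x unfolding tt r power_mult by simp
    then show "\<xi> t (x [^] N) = 1" using \<xi>[OF t] x by (simp add: character_nat_pow)
  qed
  then have bdd: "bounded_comm_group G N" using N0 by unfold_locales
  have "infinite ((\<lambda>x. x [^] (N div p)) ` carrier G)" if p: "Factorial_Ring.prime p" "p dvd N" for p
  proof -
    obtain q where "q \<in> M" "p dvd q ^ n q"
      using prime_dvd_prod_iff[OF M p(1), of "\<lambda>q. q ^ n q"] p(2) by (auto simp: N_def)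
    then have pM: "p \<in> M" using pr p(1) prime_dvd_power primes_dvd_imp_eq by metis
    let ?t = "\<lambda>x. (p, n p, x)"
    have tI: "?t x \<in> ?I" if "x \<in> K p (n p)" for x using that pM n1[OF pM] by simp
    let ?y = "\<lambda>x. g (?t x) [^] (N div p)"
    have "\<not> p ^ n p dvd N div p"
    proof
      assume "p ^ n p dvd N div p"
      then have "p ^ n p * p dvd N" using p(2) by (metis dvd_div_mult_self mult_dvd_mono dvd_refl)
      moreover have "N = p ^ n p * (\<Prod>q\<in>M - {p}. q ^ n q)" unfolding N_def using M pM by (rule prod.remove)
      ultimately have "p dvd (\<Prod>q\<in>M - {p}. q ^ n q)" using p(1) by (simp add: prime_gt_0_nat)
      then obtain q where q: "q \<in> M - {p}" "p dvd q ^ n q"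
        using prime_dvd_prod_iff[OF _ p(1), of "M - {p}"] M by auto
      then have "p dvd q" using p prime_dvd_power by blast
      then show False using q(1) p pr[of q] primes_dvd_imp_eq by auto
    qed
    then have ne: "\<xi> (?t x) (?y x) \<noteq> 1" if "x \<in> K p (n p)" for x
      using gen[OF tI[OF that]] cis_root_power_eq_1[of "p ^ n p" "N div p"] p(1)
        character_nat_pow[OF \<xi>[OF tI[OF that]] g[OF tI[OF that]], of "N div p"]
      by (auto simp: prime_gt_0_nat)
    have one: "\<xi> (?t x) (?y x') = 1" if "x \<in> K p (n p)" "x' \<in> K p (n p)" "x \<noteq> x'" for x x'
      using orth[OF tI[OF that(1)] tI[OF that(2)]] that(3)
        character_nat_pow[OF \<xi>[OF tI[OF that(1)]] g[OF tI[OF that(2)]], of "N div p"] by simp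
    have "inj_on ?y (K p (n p))"
    proof (rule inj_onI, rule ccontr)
      fix x x' assume *: "x \<in> K p (n p)" "x' \<in> K p (n p)" "?y x = ?y x'" "x \<noteq> x'"
      then show False using ne[of x] one[of x x'] by simp
    qed
    then have "infinite (?y ` K p (n p))" using inf[OF pM] finite_imageD by blast
    moreover have "?y ` K p (n p) \<subseteq> (\<lambda>x. x [^] (N div p)) ` carrier G" using g tI by blast
    ultimately show ?thesis using infinite_super by blast
  qed
  then show ?thesis using bdd by blast
qed

context bounded_comm_group
begin

lemma character_root: "\<lbrakk>character h; x \<in> carrier G\<rbrakk> \<Longrightarrow> h x ^ N = 1"
  using character_nat_pow[of h x N] pow_N[of x] by simp

lemma finite_N_roots: "finite {z::complex. z ^ N = 1}"
  using N_pos by (intro finite_roots_unity) simp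

lemma int_pow_eq_one_if_dvd: "\<lbrakk>x \<in> carrier G; int N dvd a\<rbrakk> \<Longrightarrow> x [^] a = \<one>"
  using int_pow_eq_id[of x a] ord_dvd_N[of x] by (meson dvd_trans of_nat_dvd_iff)

lemma finite_generate:
  assumes "finite S" "S \<subseteq> carrier G"
  shows "finite (generate G S)"
  using assms
proof (induction S rule: finite_induct)
  case empty
  then show ?case by (simp add: generate_empty)
next
  case (insert a S)
  let ?T = "generate G S"
  have fin: "finite ?T" and ac: "a \<in> carrier G" and Sc: "S \<subseteq> carrier G" using insert by auto
  have sub: "subgroup ?T G" using generate_is_subgroup[OF Sc] .
  have Tc: "\<And>x. x \<in> ?T \<Longrightarrow> x \<in> carrier G" using generate_in_carrier[OF Sc] .
  define R where "R = (\<lambda>(x, k). x \<otimes> a [^] (k::int)) ` (?T \<times> {0..<int N})"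
  have RI: "x \<otimes> a [^] k \<in> R" if x: "x \<in> ?T" for x and k :: int
  proof -
    have "int N dvd k - k mod int N" by (simp add: dvd_minus_mod)
    then have "a [^] (k - k mod int N) = \<one>" using int_pow_eq_one_if_dvd ac by blast
    then have "a [^] k = a [^] (k mod int N)" using ac
      by (metis int_pow_closed int_pow_diff inv_closed inv_equality inv_inv)
    moreover have "k mod int N \<in> {0..<int N}" using N_pos by simp
    ultimately show ?thesis using x unfolding R_def by force
  qed
  have RE: "\<exists>x\<in>?T. \<exists>k::int. r = x \<otimes> a [^] k" if "r \<in> R" for r
    using that unfolding R_def by auto
  have "subgroup R G"
  proof (rule subgroupI)
    show "R \<subseteq> carrier G" using ac Tc unfolding R_def by auto
    show "R \<noteq> {}" using RI[OF generate.one] by blast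
    fix r assume "r \<in> R"
    then obtain x and k :: int where r: "x \<in> ?T" "r = x \<otimes> a [^] k" using RE by blast
    have "inv r = inv x \<otimes> a [^] (- k)"
      using r(2) Tc[OF r(1)] ac by (simp add: inv_mult int_pow_neg)
    then show "inv r \<in> R" using RI[OF subgroup.m_inv_closed[OF sub r(1)]] by simp
    fix r' assume "r' \<in> R"
    then obtain x' and k' :: int where r': "x' \<in> ?T" "r' = x' \<otimes> a [^] k'" using RE by blast
    have "r \<otimes> r' = (x \<otimes> x') \<otimes> a [^] (k + k')"
      using r(2) r'(2) Tc[OF r(1)] Tc[OF r'(1)] ac by (simp add: int_pow_mult m_ac)
    then show "r \<otimes> r' \<in> R" using RI[OF subgroup.m_closed[OF sub r(1) r'(1)]] by simp
  qed
  moreover have "insert a S \<subseteq> R"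
  proof
    fix y assume "y \<in> insert a S"
    then consider "y = a" | "y \<in> S" by blast
    then show "y \<in> R"
    proof cases
      case 1
      then show ?thesis using RI[OF generate.one, of 1] ac by simp
    next
      case 2
      then show ?thesis using RI[OF generate.incl[OF 2], of 0] Sc by auto
    qed
  qed
  ultimately have "generate G (insert a S) \<subseteq> R" by (rule generate_subgroup_incl[rotated])
  moreover have "finite R" using fin unfolding R_def by simp
  ultimately show ?case by (rule finite_subset)
qed

text \<open>
  Each character takes finitely many values, so infinitely many \<open>k\<close>-th powers have roots on which all \<open>h \<in> Z\<close>
  agree. The quotients of these roots by a fixed one are killed by \<open>Z\<close> and still have infinitely many \<open>k\<close>-th
  powers.
\<close>
lemma power_avoiding_finite_set:
  assumes inf: "infinite ((\<lambda>x. x [^] (k::nat)) ` carrier G)" and F: "finite F"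
    and Z: "finite Z" "\<And>h. h \<in> Z \<Longrightarrow> character h"
  shows "\<exists>y\<in>carrier G. (\<forall>h\<in>Z. h y = 1) \<and> y [^] k \<notin> F"
proof -
  let ?A = "(\<lambda>x. x [^] k) ` carrier G"
  define r where "r = (\<lambda>a. SOME x. x \<in> carrier G \<and> x [^] k = a)"
  have r: "r a \<in> carrier G \<and> r a [^] k = a" if "a \<in> ?A" for a
  proof -
    obtain x where "x \<in> carrier G \<and> x [^] k = a" using \<open>a \<in> ?A\<close> by blast
    then show ?thesis unfolding r_def by (rule someI)
  qed
  let ?f = "\<lambda>a. \<lambda>h\<in>Z. h (r a)"
  have "?f ` ?A \<subseteq> PiE Z (\<lambda>_. {z. z ^ N = 1})"
  proof (rule image_subsetI)
    fix a assume "a \<in> ?A"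
    then have "r a \<in> carrier G" using r by blast
    then show "?f a \<in> PiE Z (\<lambda>_. {z. z ^ N = 1})" using Z(2) character_root by simp
  qed
  moreover have "finite (PiE Z (\<lambda>_. {z::complex. z ^ N = 1}))"
    using Z(1) finite_N_roots by (intro finite_PiE)
  ultimately have "finite (?f ` ?A)" by (rule finite_subset)
  then obtain a0 where a0: "a0 \<in> ?A" "infinite {a \<in> ?A. ?f a = ?f a0}"
    using pigeonhole_infinite[OF inf] by blast
  let ?B = "{a \<in> ?A. ?f a = ?f a0}"
  have a0c: "a0 \<in> carrier G" using a0(1) by auto
  have "inj_on (\<lambda>a. a \<otimes> inv a0) ?B"
    using a0c by (intro inj_onI) (auto simp: right_cancel)
  then have "infinite ((\<lambda>a. a \<otimes> inv a0) ` ?B)" using a0(2) finite_imageD by blast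
  then have "\<not> (\<lambda>a. a \<otimes> inv a0) ` ?B \<subseteq> F" using F finite_subset by blast
  then obtain b where b: "b \<in> (\<lambda>a. a \<otimes> inv a0) ` ?B" "b \<notin> F" by blast
  then obtain a where a: "a \<in> ?B" "b = a \<otimes> inv a0" by blast
  have ra: "r a \<in> carrier G" "r a [^] k = a" and ra0: "r a0 \<in> carrier G" "r a0 [^] k = a0"
    using r a(1) a0(1) by auto
  show ?thesis
  proof (intro bexI[of _ "r a \<otimes> inv r a0"] conjI ballI)
    show "r a \<otimes> inv r a0 \<in> carrier G" using ra ra0 by simp
    have "(r a \<otimes> inv r a0) [^] k = b"
      using ra ra0 a(2) by (simp add: nat_pow_distrib nat_pow_inv)
    then show "(r a \<otimes> inv r a0) [^] k \<notin> F" using b by simp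
    fix h assume h: "h \<in> Z"
    have "h (r a) = h (r a0)"
    proof -
      have "?f a = ?f a0" using a(1) by blast
      from fun_cong[OF this, of h] show ?thesis using h by simp
    qed
    moreover have "h (r a0) \<noteq> 0" using character_norm[OF Z(2)[OF h] ra0(1)] by auto
    ultimately show "h (r a \<otimes> inv r a0) = 1"
      using Z(2)[OF h] ra ra0 by (simp add: character_mult character_inv)
  qed
qed

text \<open>
  An element \<open>e\<close> has order \<open>N\<close> modulo \<open>F\<close> as soon as its \<open>(N/p)\<close>-th power avoids \<open>F\<close> for each prime \<open>p\<close> dividing \<open>N\<close>.
  Elements \<open>y p\<close> that do this for a single \<open>p\<close> are combined into one by first projecting
  each to its \<open>p\<close>-component, which is the effect of the exponents \<open>c p\<close>.
\<close>
lemma element_independent_of_finite_subgroup: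
  assumes inf: "\<And>p. \<lbrakk>Factorial_Ring.prime p; p dvd N\<rbrakk> \<Longrightarrow> infinite ((\<lambda>x. x [^] (N div p)) ` carrier G)"
    and F: "finite F" "subgroup F G" and Z: "finite Z" "\<And>h. h \<in> Z \<Longrightarrow> character h"
  shows "\<exists>e\<in>carrier G. (\<forall>h\<in>Z. h e = 1) \<and> (\<forall>a::int. e [^] a \<in> F \<longrightarrow> int N dvd a)"
proof -
  let ?P = "{p. Factorial_Ring.prime p \<and> p dvd N}"
  have finP: "finite ?P" using N_pos by (intro finite_subset[OF _ finite_divisors_nat[of N]]) auto
  have "\<forall>p\<in>?P. \<exists>y. y \<in> carrier G \<and> (\<forall>h\<in>Z. h y = 1) \<and> y [^] (N div p) \<notin> F"
    using power_avoiding_finite_set[OF inf F(1) Z] by auto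
  from bchoice[OF this] obtain y where
    y: "\<forall>p\<in>?P. y p \<in> carrier G \<and> (\<forall>h\<in>Z. h (y p) = 1) \<and> y p [^] (N div p) \<notin> F" by (rule exE)
  define c where "c = (\<lambda>p. N div p ^ multiplicity p N)"
  have c: "N = p ^ multiplicity p N * c p" for p
    unfolding c_def by (simp add: multiplicity_dvd)
  define e where "e = finprod G (\<lambda>p. y p [^] c p) ?P"
  have yc: "(\<lambda>p. y p [^] c p) \<in> ?P \<rightarrow> carrier G" using y by simp
  have ec: "e \<in> carrier G" unfolding e_def using yc by (rule finprod_closed)
  have "h e = 1" if h: "h \<in> Z" for h
  proof -
    have hc: "character h" using Z(2)[OF h] .
    have sub: "subgroup {x \<in> carrier G. h x = 1} G"
      using hc by (intro subgroupI) (auto simp: character_inv character_mult)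
    have "e \<in> {x \<in> carrier G. h x = 1}"
      unfolding e_def
    proof (rule subgroup_finprod_closed[OF sub])
      fix p assume p: "p \<in> ?P"
      then have "y p \<in> carrier G" "h (y p) = 1" using y h by blast+
      then show "y p [^] c p \<in> {x \<in> carrier G. h x = 1}" using hc by (simp add: character_nat_pow)
    qed
    then show ?thesis by simp
  qed
  moreover have "int N dvd a" if a: "e [^] a \<in> F" for a :: int
  proof (rule ccontr)
    assume "\<not> int N dvd a"
    define d where "d = gcd a (int N)"
    obtain u v where uv: "u * a + v * int N = d" using bezout_int unfolding d_def by blast
    have "e [^] d = (e [^] a) [^] u \<otimes> (e [^] int N) [^] v"
      unfolding uv[symmetric] using ec by (simp add: int_pow_mult int_pow_pow mult.commute)
    moreover have "e [^] int N = \<one>" using int_pow_eq_one_if_dvd[OF ec] by simp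
    ultimately have "e [^] d = (e [^] a) [^] u" using ec by simp
    then have edF: "e [^] d \<in> F" using a F(2) subgroup_int_pow_closed by metis
    have d0: "d > 0" unfolding d_def using N_pos by simp
    have dN: "nat d dvd N" unfolding d_def by (metis gcd_dvd2 gcd_ge_0_int nat_dvd_iff nat_int of_nat_dvd_iff int_nat_eq)
    have "nat d \<noteq> N" using \<open>\<not> int N dvd a\<close> d0 unfolding d_def by (metis gcd_dvd1 int_nat_eq less_imp_le)
    then obtain p where p: "Factorial_Ring.prime p" "p dvd N div nat d"
      using prime_factor_nat[of "N div nat d"] dN N_pos
      by (metis dvd_div_mult_self mult_1)
    have pd: "nat d * p dvd N" using p(2) dN by (metis dvd_div_mult_self mult.commute mult_dvd_mono dvd_refl)
    then have pP: "p \<in> ?P" using p(1) by (auto dest: dvd_mult_right)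
    have "nat d dvd N div p" using pd p(1) by (metis dvd_mult_imp_div)
    then obtain r where r: "N div p = nat d * r" by blast
    have "e [^] (N div p) = (e [^] d) [^] int r"
      using ec d0 by (simp add: int_pow_pow r flip: int_pow_int)
    then have eF: "e [^] (N div p) \<in> F" using edF F(2) subgroup_int_pow_closed by metis
    let ?z = "\<lambda>q. (y q [^] c q) [^] int (N div p)"
    have "e [^] int (N div p) = finprod G ?z ?P"
      unfolding e_def using yc by (rule finprod_int_pow)
    also have "\<dots> = finprod G ?z {p}"
    proof (rule finprod_mono_neutral_cong_right)
      show "{p} \<subseteq> ?P" using pP by blast
      show "?z q = \<one>" if q: "q \<in> ?P - {p}" for q
      proof -
        have "coprime (q ^ multiplicity q N) p"
          using q p(1) primes_coprime[of q p] by auto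
        moreover have "q ^ multiplicity q N dvd p * (N div p)"
          using pP by (simp add: multiplicity_dvd)
        ultimately have "q ^ multiplicity q N dvd N div p" by (simp add: coprime_dvd_mult_right_iff)
        then obtain w where w: "N div p = q ^ multiplicity q N * w" by blast
        have "c q * (N div p) = N * w" unfolding w using c[of q] by (metis mult.assoc mult.commute)
        then have "int N dvd int (c q * (N div p))" by simp
        moreover have yq: "y q \<in> carrier G" using y q by blast
        ultimately have "y q [^] int (c q * (N div p)) = \<one>" by (intro int_pow_eq_one_if_dvd)
        then show "?z q = \<one>" by (simp only: int_pow_int nat_pow_pow[OF yq])
      qed
    qed (use yc finP in \<open>auto simp: Pi_iff\<close>)
    also have "\<dots> = ?z p" using yc pP by (simp add: Pi_iff)
    finally have zF: "?z p \<in> F" using eF by (simp add: int_pow_int)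
    have ypc: "y p \<in> carrier G" using y pP by blast
    let ?w = "y p [^] (N div p)"
    have wc: "?w \<in> carrier G" using ypc by simp
    have zw: "?z p = ?w [^] int (c p)" by (simp only: int_pow_int nat_pow_pow[OF ypc] mult.commute)
    have wp: "?w [^] int p = \<one>"
    proof -
      have "N div p * p = N" using pP by simp
      then show ?thesis using pow_N[OF ypc] by (simp only: int_pow_int nat_pow_pow[OF ypc])
    qed
    have "\<not> p dvd c p"
      unfolding c_def using multiplicity_decompose[of N p] N_pos p(1) by (metis not_prime_unit less_irrefl)
    then have "coprime (int (c p)) (int p)"
      using p(1) by (metis coprime_commute coprime_int_iff prime_imp_coprime)
    then obtain u v where uv: "u * int (c p) + v * int p = 1"
      using bezout_int[of "int (c p)" "int p"] by auto
    have "?w = ?w [^] (int (c p) * u + int p * v)" using uv wc by (simp add: mult.commute)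
    also have "\<dots> = (?w [^] int (c p)) [^] u \<otimes> (?w [^] int p) [^] v"
      using wc by (simp add: int_pow_mult int_pow_pow)
    also have "\<dots> = ?z p [^] u" using wp zw wc by simp
    finally have "?w \<in> F" using zF F(2) subgroup_int_pow_closed by metis
    then show False using y pP by blast
  qed
  ultimately show ?thesis using ec by blast
qed

text \<open>
  At each stage the elements to be independent of generate a finite subgroup, and the characters to be killed are
  those that are nontrivial at one of the finitely many elements already chosen.
\<close>
lemma fresh_sequence:
  fixes h :: "nat \<Rightarrow> 'a"
  assumes inf: "\<And>p. \<lbrakk>Factorial_Ring.prime p; p dvd N\<rbrakk> \<Longrightarrow> infinite ((\<lambda>x. x [^] (N div p)) ` carrier G)"
    and h: "range h \<subseteq> carrier G"
    and X: "\<And>\<xi>. \<xi> \<in> X \<Longrightarrow> character \<xi>" "\<And>y. y \<in> carrier G \<Longrightarrow> finite {\<xi> \<in> X. \<xi> y \<noteq> 1}"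
  obtains e :: "nat \<Rightarrow> 'a" where "range e \<subseteq> carrier G"
    "\<And>i a. e i [^] (a::int) \<in> generate G (h ` {..i} \<union> e ` {..<i}) \<Longrightarrow> int N dvd a"
    "\<And>i j \<xi>. \<lbrakk>\<xi> \<in> X; j < i; \<xi> (e j) \<noteq> 1\<rbrakk> \<Longrightarrow> \<xi> (e i) = 1"
proof -
  define P where "P = (\<lambda>(f :: nat \<Rightarrow> 'a) i r. r \<in> carrier G \<and>
     (\<forall>a::int. r [^] a \<in> generate G (h ` {..i} \<union> f ` {..<i}) \<longrightarrow> int N dvd a) \<and>
     (\<forall>\<xi>\<in>X. (\<exists>j<i. \<xi> (f j) \<noteq> 1) \<longrightarrow> \<xi> r = 1))"
  have "\<exists>f. \<forall>i. P f i (f i)"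
  proof (rule dependent_wellorder_choice)
    fix r i and f g :: "nat \<Rightarrow> 'a" assume fg: "\<And>j. j < i \<Longrightarrow> f j = g j"
    then have "f ` {..<i} = g ` {..<i}" by (intro image_cong) auto
    moreover have "(\<exists>j<i. \<xi> (f j) \<noteq> 1) \<longleftrightarrow> (\<exists>j<i. \<xi> (g j) \<noteq> 1)" for \<xi> :: "'a \<Rightarrow> complex"
      using fg by auto
    ultimately show "P f i r = P g i r" by (simp add: P_def)
  next
    fix i and f :: "nat \<Rightarrow> 'a" assume f: "\<And>j. j < i \<Longrightarrow> P f j (f j)"
    then have fc: "f j \<in> carrier G" if "j < i" for j using that by (simp add: P_def)
    let ?S = "h ` {..i} \<union> f ` {..<i}"
    have S: "?S \<subseteq> carrier G" using fc h by auto
    have "finite (generate G ?S)" using S by (intro finite_generate) auto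
    moreover have "subgroup (generate G ?S) G" using S by (rule generate_is_subgroup)
    moreover have "finite (\<Union>j<i. {\<xi> \<in> X. \<xi> (f j) \<noteq> 1})" using X(2) fc by auto
    ultimately obtain e where "e \<in> carrier G" "\<forall>\<xi>\<in>(\<Union>j<i. {\<xi> \<in> X. \<xi> (f j) \<noteq> 1}). \<xi> e = 1"
       "\<forall>a::int. e [^] a \<in> generate G ?S \<longrightarrow> int N dvd a"
      using element_independent_of_finite_subgroup[OF inf, of "generate G ?S" "\<Union>j<i. {\<xi> \<in> X. \<xi> (f j) \<noteq> 1}"] X(1)
      by auto
    then have "P f i e" unfolding P_def by blast
    then show "\<exists>r. P f i r" by blast
  qed
  then obtain e where e: "\<And>i. P e i (e i)" by blast
  show thesis
  proof (rule that[of e])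
    show "range e \<subseteq> carrier G" using e by (auto simp: P_def)
    show "int N dvd a" if "e i [^] a \<in> generate G (h ` {..i} \<union> e ` {..<i})" for i and a :: int
      using e[of i] that unfolding P_def by blast
    show "\<xi> (e i) = 1" if "\<xi> \<in> X" "j < i" "\<xi> (e j) \<noteq> 1" for i j \<xi>
      using e[of i] that unfolding P_def by blast
  qed
qed

end

section \<open>Complete topologies in which blocks of elements vanish\<close>

text \<open>
  Finite symmetric sets \<open>D 0, D 1, \<dots>\<close> are to converge to the neutral element. The topology below is the finest group topology
  with this property.
\<close>
locale vanishing_blocks = comm_group G for G (structure) +
  fixes D :: "nat \<Rightarrow> 'a set"
  assumes D_finite: "finite (D k)" and D_carrier: "D k \<subseteq> carrier G"
    and D_inv: "x \<in> D k \<Longrightarrow> inv x \<in> D k"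
begin

definition tail :: "nat \<Rightarrow> 'a set" where
  "tail m = insert \<one> (\<Union>k\<in>{m..}. D k)"

text \<open>
  The products of \<open>k\<close> factors, the \<open>i\<close>-th of which comes from the blocks with index at least \<open>s i\<close>. A rapidly growing \<open>s\<close>
  thus restricts the number of factors that may come from any initial segment of blocks.
\<close>
primrec tail_products :: "(nat \<Rightarrow> nat) \<Rightarrow> nat \<Rightarrow> 'a set" where
  "tail_products s 0 = {\<one>}"
| "tail_products s (Suc k) = {x \<otimes> y |x y. x \<in> tail_products s k \<and> y \<in> tail (s k)}"

definition nbhd :: "(nat \<Rightarrow> nat) \<Rightarrow> 'a set" where
  "nbhd s = (\<Union>k. tail_products s k)"

lemma tail_carrier: "tail m \<subseteq> carrier G"
  using D_carrier by (auto simp: tail_def)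

lemma tail_antimono: "m \<le> m' \<Longrightarrow> tail m' \<subseteq> tail m"
  by (force simp: tail_def)

lemma tail_inv: "x \<in> tail m \<Longrightarrow> inv x \<in> tail m"
  using D_inv by (auto simp: tail_def)

lemma one_in_tail [simp]: "\<one> \<in> tail m"
  by (simp add: tail_def)

lemma tail_products_carrier: "tail_products s k \<subseteq> carrier G"
  using tail_carrier by (induction k) auto

lemma nbhd_carrier: "nbhd s \<subseteq> carrier G"
  using tail_products_carrier by (auto simp: nbhd_def)

lemma in_tail_carrier: "x \<in> tail m \<Longrightarrow> x \<in> carrier G"
  using tail_carrier by blast

lemma in_tail_products_carrier: "x \<in> tail_products s k \<Longrightarrow> x \<in> carrier G"
  using tail_products_carrier by blast

lemma in_nbhd_carrier: "x \<in> nbhd s \<Longrightarrow> x \<in> carrier G"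
  using nbhd_carrier by blast

lemma tail_products_SucI: "\<lbrakk>x \<in> tail_products s k; y \<in> tail (s k)\<rbrakk> \<Longrightarrow> x \<otimes> y \<in> tail_products s (Suc k)"
  by auto

lemma tail_products_Suc_subset: "tail_products s k \<subseteq> tail_products s (Suc k)"
proof
  fix x assume x: "x \<in> tail_products s k"
  then show "x \<in> tail_products s (Suc k)"
    using tail_products_SucI[OF x one_in_tail] in_tail_products_carrier[OF x] by (simp only: r_one)
qed

lemma tail_products_mono: "k \<le> l \<Longrightarrow> tail_products s k \<subseteq> tail_products s l"
  by (rule lift_Suc_mono_le[of "tail_products s"]) (use tail_products_Suc_subset in auto)

lemma one_in_tail_products [simp]: "\<one> \<in> tail_products s k"
  using tail_products_mono[of 0 k s] by auto

lemma one_in_nbhd [simp]: "\<one> \<in> nbhd s"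
  using one_in_tail_products by (auto simp: nbhd_def)

lemma tail_products_antimono: "(\<And>i. s i \<le> t i) \<Longrightarrow> tail_products t k \<subseteq> tail_products s k"
proof (induction k)
  case (Suc k)
  then have "tail_products t k \<subseteq> tail_products s k" "tail (t k) \<subseteq> tail (s k)"
    using tail_antimono by auto
  then show ?case by auto
qed simp

lemma nbhd_antimono: "(\<And>i. s i \<le> t i) \<Longrightarrow> nbhd t \<subseteq> nbhd s"
  using tail_products_antimono[of s t] unfolding nbhd_def by blast

lemma tail_products_append:
  assumes "x \<in> tail_products s k" "y \<in> tail_products (\<lambda>i. s (k + i)) l"
  shows "x \<otimes> y \<in> tail_products s (k + l)"
  using assms(2)
proof (induction l arbitrary: y)
  case 0
  then have "x \<otimes> y = x" using assms(1) tail_products_carrier[of s k] by auto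
  then show ?case using assms(1) by simp
next
  case (Suc l)
  then obtain a b where y: "y = a \<otimes> b" "a \<in> tail_products (\<lambda>i. s (k + i)) l" "b \<in> tail (s (k + l))" by auto
  then have "x \<otimes> y = (x \<otimes> a) \<otimes> b"
    using assms(1) tail_products_carrier tail_carrier by (metis m_assoc subsetD)
  then show ?case using Suc.IH[OF y(2)] y(3) by auto
qed

lemma tail_products_split:
  assumes "x \<in> tail_products s (k + l)"
  shows "\<exists>a\<in>tail_products s k. \<exists>b\<in>tail_products (\<lambda>i. s (k + i)) l. x = a \<otimes> b"
  using assms
proof (induction l arbitrary: x)
  case 0
  then have "x \<in> tail_products s k" by simp
  moreover from this have "x = x \<otimes> \<one>" using tail_products_carrier[of s k] by auto
  ultimately show ?case by (intro bexI[of _ x] bexI[of _ \<one>]) simp_all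
next
  case (Suc l)
  then obtain y c where x: "x = y \<otimes> c" "y \<in> tail_products s (k + l)" "c \<in> tail (s (k + l))" by auto
  then obtain a b where ab: "a \<in> tail_products s k" "b \<in> tail_products (\<lambda>i. s (k + i)) l" "y = a \<otimes> b"
    using Suc.IH by blast
  then have "x = a \<otimes> (b \<otimes> c)"
    using x tail_products_carrier tail_carrier by (metis m_assoc subsetD)
  moreover have "b \<otimes> c \<in> tail_products (\<lambda>i. s (k + i)) (Suc l)" using ab x by auto
  ultimately show ?case using ab by blast
qed

text \<open>
  The sets \<open>nbhd s\<close> are open themselves, since a product with \<open>k\<close> factors may be prolonged by further factors according to the
  shifted
\<close>
lemma nbhd_translate:
  assumes "y \<in> nbhd s"
  shows "\<exists>t. \<forall>z\<in>nbhd t. y \<otimes> z \<in> nbhd s"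
proof -
  obtain k where "y \<in> tail_products s k" using assms by (auto simp: nbhd_def)
  then have "\<forall>z\<in>nbhd (\<lambda>i. s (k + i)). y \<otimes> z \<in> nbhd s"
    using tail_products_append unfolding nbhd_def by blast
  then show ?thesis by blast
qed

text \<open>The factors of \<open>x\<close> and \<open>y\<close> are interleaved.\<close>
lemma tail_products_double:
  assumes "x \<in> tail_products (\<lambda>i. max (t (2 * i)) (t (2 * i + 1))) k"
    "y \<in> tail_products (\<lambda>i. max (t (2 * i)) (t (2 * i + 1))) k"
  shows "x \<otimes> y \<in> tail_products t (2 * k)"
  using assms
proof (induction k arbitrary: x y)
  case (Suc k)
  let ?s = "\<lambda>i. max (t (2 * i)) (t (2 * i + 1))"
  obtain a b where x: "x = a \<otimes> b" "a \<in> tail_products ?s k" "b \<in> tail (?s k)" using Suc.prems(1) by auto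
  obtain c d where y: "y = c \<otimes> d" "c \<in> tail_products ?s k" "d \<in> tail (?s k)" using Suc.prems(2) by auto
  have carr: "a \<in> carrier G" "b \<in> carrier G" "c \<in> carrier G" "d \<in> carrier G"
    using x y tail_products_carrier tail_carrier by blast+
  have "x \<otimes> y = ((a \<otimes> c) \<otimes> b) \<otimes> d"
    unfolding x y using carr by (simp add: m_ac)
  moreover have "a \<otimes> c \<in> tail_products t (2 * k)" using Suc.IH x y by blast
  moreover have "b \<in> tail (t (2 * k))" "d \<in> tail (t (Suc (2 * k)))"
    using x(3) y(3) tail_antimono[of "t (2 * k)" "?s k"] tail_antimono[of "t (Suc (2 * k))" "?s k"] by auto
  ultimately have "x \<otimes> y \<in> tail_products t (Suc (Suc (2 * k)))" by (simp only: tail_products_SucI)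
  then show ?case by simp
qed auto

lemma nbhd_halve: "\<exists>s. \<forall>x\<in>nbhd s. \<forall>y\<in>nbhd s. x \<otimes> y \<in> nbhd t"
proof -
  let ?s = "\<lambda>i. max (t (2 * i)) (t (2 * i + 1))"
  have "x \<otimes> y \<in> nbhd t" if xy: "x \<in> nbhd ?s" "y \<in> nbhd ?s" for x y
  proof -
    obtain k l where "x \<in> tail_products ?s k" "y \<in> tail_products ?s l" using xy unfolding nbhd_def by blast
    then have "x \<in> tail_products ?s (max k l)" "y \<in> tail_products ?s (max k l)"
      using tail_products_mono[of k "max k l" ?s] tail_products_mono[of l "max k l" ?s] by auto
    then show ?thesis using tail_products_double unfolding nbhd_def by blast
  qed
  then show ?thesis by blast
qed

lemma tail_products_inv: "x \<in> tail_products s k \<Longrightarrow> inv x \<in> tail_products s k"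
proof (induction k arbitrary: x)
  case (Suc k)
  then obtain a b where x: "x = a \<otimes> b" "a \<in> tail_products s k" "b \<in> tail (s k)" by auto
  then have "inv x = inv a \<otimes> inv b" using tail_products_carrier tail_carrier inv_mult by blast
  then show ?case using Suc.IH[OF x(2)] tail_inv[OF x(3)] by auto
qed simp

lemma nbhd_inv: "x \<in> nbhd s \<Longrightarrow> inv x \<in> nbhd s"
  using tail_products_inv unfolding nbhd_def by blast

lemma tail_subset_nbhd: "tail (s 0) \<subseteq> nbhd s"
proof
  fix x assume x: "x \<in> tail (s 0)"
  then have "\<one> \<otimes> x \<in> tail_products s (Suc 0)" using tail_products_SucI[of \<one> s 0 x] by simp
  then have "x \<in> tail_products s (Suc 0)" using in_tail_carrier[OF x] by (simp only: l_one)
  then show "x \<in> nbhd s" unfolding nbhd_def by blast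
qed

lemma nbhd_finite_Inter:
  assumes "finite S" "S \<noteq> {}"
  shows "nbhd (\<lambda>i. Max ((\<lambda>s. s i) ` S)) \<subseteq> (\<Inter>s\<in>S. nbhd s)"
proof clarify
  fix x s assume "x \<in> nbhd (\<lambda>i. Max ((\<lambda>s. s i) ` S))" and s: "s \<in> S"
  moreover have "s i \<le> Max ((\<lambda>s. s i) ` S)" for i using s assms by simp
  then have "nbhd (\<lambda>i. Max ((\<lambda>s. s i) ` S)) \<subseteq> nbhd s" by (rule nbhd_antimono)
  ultimately show "x \<in> nbhd s" by blast
qed

definition block_topology :: "'a topology" where
  "block_topology = topology (\<lambda>U. U \<subseteq> carrier G \<and> (\<forall>x\<in>U. \<exists>s. \<forall>z\<in>nbhd s. x \<otimes> z \<in> U))"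

lemma openin_block_topology:
  "openin block_topology U \<longleftrightarrow> U \<subseteq> carrier G \<and> (\<forall>x\<in>U. \<exists>s. \<forall>z\<in>nbhd s. x \<otimes> z \<in> U)"
proof -
  have "istopology (\<lambda>U. U \<subseteq> carrier G \<and> (\<forall>x\<in>U. \<exists>s. \<forall>z\<in>nbhd s. x \<otimes> z \<in> U))"
    unfolding istopology_def
  proof (intro conjI allI impI)
    fix S T assume S: "S \<subseteq> carrier G \<and> (\<forall>x\<in>S. \<exists>s. \<forall>z\<in>nbhd s. x \<otimes> z \<in> S)"
      and T: "T \<subseteq> carrier G \<and> (\<forall>x\<in>T. \<exists>s. \<forall>z\<in>nbhd s. x \<otimes> z \<in> T)"
    show "\<forall>x\<in>S \<inter> T. \<exists>s. \<forall>z\<in>nbhd s. x \<otimes> z \<in> S \<inter> T"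
    proof
      fix x assume "x \<in> S \<inter> T"
      then obtain s t where "\<forall>z\<in>nbhd s. x \<otimes> z \<in> S" "\<forall>z\<in>nbhd t. x \<otimes> z \<in> T" using S T by blast
      moreover have "nbhd (\<lambda>i. max (s i) (t i)) \<subseteq> nbhd s" "nbhd (\<lambda>i. max (s i) (t i)) \<subseteq> nbhd t"
        by (rule nbhd_antimono, simp)+
      ultimately show "\<exists>s. \<forall>z\<in>nbhd s. x \<otimes> z \<in> S \<inter> T" by blast
    qed
    show "S \<inter> T \<subseteq> carrier G" using S by blast
  next
    fix \<K> assume K: "\<forall>K\<in>\<K>. K \<subseteq> carrier G \<and> (\<forall>x\<in>K. \<exists>s. \<forall>z\<in>nbhd s. x \<otimes> z \<in> K)"
    then show "\<Union> \<K> \<subseteq> carrier G" by blast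
    show "\<forall>x\<in>\<Union> \<K>. \<exists>s. \<forall>z\<in>nbhd s. x \<otimes> z \<in> \<Union> \<K>" using K by (meson UnionE UnionI)
  qed
  then show ?thesis unfolding block_topology_def by (simp add: topology_inverse')
qed

lemma topspace_block_topology [simp]: "topspace block_topology = carrier G"
proof
  show "topspace block_topology \<subseteq> carrier G"
    unfolding topspace_def using openin_block_topology by blast
  have "openin block_topology (carrier G)"
    unfolding openin_block_topology using nbhd_carrier by blast
  then show "carrier G \<subseteq> topspace block_topology" by (rule openin_subset)
qed

lemma openin_translate_nbhd:
  assumes "x \<in> carrier G"
  shows "openin block_topology ((\<lambda>z. x \<otimes> z) ` nbhd s)"
  unfolding openin_block_topology
proof (intro conjI ballI)
  show "(\<lambda>z. x \<otimes> z) ` nbhd s \<subseteq> carrier G" using assms in_nbhd_carrier by auto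
  fix y assume "y \<in> (\<lambda>z. x \<otimes> z) ` nbhd s"
  then obtain z where z: "z \<in> nbhd s" "y = x \<otimes> z" by blast
  then obtain t where t: "\<forall>w\<in>nbhd t. z \<otimes> w \<in> nbhd s" using nbhd_translate by blast
  have "y \<otimes> w \<in> (\<lambda>z. x \<otimes> z) ` nbhd s" if w: "w \<in> nbhd t" for w
  proof -
    have "y \<otimes> w = x \<otimes> (z \<otimes> w)"
      using z w assms nbhd_carrier by (metis m_assoc subsetD)
    then show ?thesis using t w by blast
  qed
  then show "\<exists>t. \<forall>w\<in>nbhd t. y \<otimes> w \<in> (\<lambda>z. x \<otimes> z) ` nbhd s" by blast
qed

lemma in_translate_nbhd: "x \<in> carrier G \<Longrightarrow> x \<in> (\<lambda>z. x \<otimes> z) ` nbhd s"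
  by (rule image_eqI[of _ _ \<one>]) auto

lemma openin_nbhd: "openin block_topology (nbhd s)"
proof -
  have "(\<lambda>z. \<one> \<otimes> z) ` nbhd s = nbhd s" using nbhd_carrier by force
  then show ?thesis using openin_translate_nbhd[of \<one> s] by simp
qed

lemma group_topology_block_topology: "group_topology G block_topology"
  unfolding group_topology_def
proof (intro conjI)
  show "topspace block_topology = carrier G" by simp
  show "continuous_map block_topology block_topology (\<lambda>x. inv x)"
    unfolding continuous_map
  proof (intro conjI allI impI)
    fix U assume U: "openin block_topology U"
    show "openin block_topology {x \<in> topspace block_topology. inv x \<in> U}"
      unfolding openin_block_topology
    proof (intro conjI ballI)
      fix x assume "x \<in> {x \<in> topspace block_topology. inv x \<in> U}"
      then have x: "x \<in> carrier G" "inv x \<in> U" by auto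
      then obtain s where s: "\<forall>z\<in>nbhd s. inv x \<otimes> z \<in> U" using U openin_block_topology by blast
      have "x \<otimes> z \<in> {x \<in> topspace block_topology. inv x \<in> U}" if z: "z \<in> nbhd s" for z
      proof -
        have zc: "z \<in> carrier G" using z nbhd_carrier by blast
        have "inv (x \<otimes> z) = inv x \<otimes> inv z" using x zc by (simp add: inv_mult)
        then show ?thesis using s nbhd_inv[OF z] x zc by auto
      qed
      then show "\<exists>s. \<forall>z\<in>nbhd s. x \<otimes> z \<in> {x \<in> topspace block_topology. inv x \<in> U}" by blast
    qed auto
  qed auto
  show "continuous_map (prod_topology block_topology block_topology) block_topology (\<lambda>(x, y). x \<otimes> y)"
    unfolding continuous_map
  proof (intro conjI allI impI)
    fix U assume U: "openin block_topology U"
    let ?W = "{p \<in> topspace (prod_topology block_topology block_topology). (\<lambda>(x, y). x \<otimes> y) p \<in> U}"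
    show "openin (prod_topology block_topology block_topology) ?W"
      unfolding openin_prod_topology_alt
    proof (intro allI impI)
      fix x y assume "(x, y) \<in> ?W"
      then have xy: "x \<in> carrier G" "y \<in> carrier G" "x \<otimes> y \<in> U" by auto
      then obtain t where t: "\<forall>z\<in>nbhd t. (x \<otimes> y) \<otimes> z \<in> U" using U openin_block_topology by blast
      obtain s where s: "\<forall>a\<in>nbhd s. \<forall>b\<in>nbhd s. a \<otimes> b \<in> nbhd t" using nbhd_halve by blast
      have "(\<lambda>z. x \<otimes> z) ` nbhd s \<times> (\<lambda>z. y \<otimes> z) ` nbhd s \<subseteq> ?W"
      proof
        fix p assume "p \<in> (\<lambda>z. x \<otimes> z) ` nbhd s \<times> (\<lambda>z. y \<otimes> z) ` nbhd s"
        then obtain a b where ab: "a \<in> nbhd s" "b \<in> nbhd s" and p: "p = (x \<otimes> a, y \<otimes> b)" by blast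
        then have c: "a \<in> carrier G" "b \<in> carrier G" using nbhd_carrier by blast+
        have "(x \<otimes> a) \<otimes> (y \<otimes> b) = (x \<otimes> y) \<otimes> (a \<otimes> b)" using xy c by (simp add: m_ac)
        then show "p \<in> ?W" using t s ab xy c p by auto
      qed
      then show "\<exists>U V. openin block_topology U \<and> openin block_topology V \<and> x \<in> U \<and> y \<in> V \<and> U \<times> V \<subseteq> ?W"
        by (intro exI[of _ "(\<lambda>z. x \<otimes> z) ` nbhd s"] exI[of _ "(\<lambda>z. y \<otimes> z) ` nbhd s"] conjI
          openin_translate_nbhd in_translate_nbhd xy)
    qed
  qed auto
qed

lemma Hausdorff_block_topology:
  assumes "\<And>x. \<lbrakk>x \<in> carrier G; x \<noteq> \<one>\<rbrakk> \<Longrightarrow> \<exists>s. x \<notin> nbhd s"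
  shows "Hausdorff_space block_topology"
  unfolding Hausdorff_space_def
proof (intro allI impI)
  fix x y assume "x \<in> topspace block_topology \<and> y \<in> topspace block_topology \<and> x \<noteq> y"
  then have xy: "x \<in> carrier G" "y \<in> carrier G" "x \<noteq> y" by auto
  then have "inv x \<otimes> y \<noteq> \<one>" by (metis inv_closed inv_equality inv_inv)
  then obtain t where t: "inv x \<otimes> y \<notin> nbhd t" using assms xy by (metis inv_closed m_closed)
  obtain s where s: "\<forall>a\<in>nbhd s. \<forall>b\<in>nbhd s. a \<otimes> b \<in> nbhd t" using nbhd_halve by blast
  have "disjnt ((\<lambda>z. x \<otimes> z) ` nbhd s) ((\<lambda>z. y \<otimes> z) ` nbhd s)"
    unfolding disjnt_iff
  proof (intro allI notI, elim conjE imageE)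
    fix u a b assume *: "u = x \<otimes> a" "a \<in> nbhd s" "u = y \<otimes> b" "b \<in> nbhd s"
    then have c: "a \<in> carrier G" "b \<in> carrier G" using nbhd_carrier by blast+
    have "inv x \<otimes> y = inv x \<otimes> (y \<otimes> b) \<otimes> inv b" using xy c by (simp add: m_assoc r_inv)
    also have "\<dots> = inv x \<otimes> (x \<otimes> a) \<otimes> inv b" using * by simp
    also have "\<dots> = a \<otimes> inv b" using xy c by (simp add: m_assoc[symmetric] l_inv)
    finally show False using t s * nbhd_inv by metis
  qed
  then show "\<exists>U V. openin block_topology U \<and> openin block_topology V \<and> x \<in> U \<and> y \<in> V \<and> disjnt U V"
    by (intro exI[of _ "(\<lambda>z. x \<otimes> z) ` nbhd s"] exI[of _ "(\<lambda>z. y \<otimes> z) ` nbhd s"] conjI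
          openin_translate_nbhd in_translate_nbhd xy)
qed

lemma compact_tail: "compactin block_topology (tail 0)"
  unfolding compactin_def
proof (intro conjI allI impI)
  show "tail 0 \<subseteq> topspace block_topology" using tail_carrier by simp
  fix \<U> assume U: "Ball \<U> (openin block_topology) \<and> tail 0 \<subseteq> \<Union> \<U>"
  then obtain V where V: "V \<in> \<U>" "\<one> \<in> V" using one_in_tail[of 0] by blast
  then obtain s where s: "\<forall>z\<in>nbhd s. \<one> \<otimes> z \<in> V" using U openin_block_topology by blast
  have tV: "tail (s 0) \<subseteq> V"
  proof
    fix x assume x: "x \<in> tail (s 0)"
    then have "\<one> \<otimes> x \<in> V" using s tail_subset_nbhd by blast
    then show "x \<in> V" using in_tail_carrier[OF x] by simp
  qed
  let ?F = "\<Union>k<s 0. D k"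
  have "?F \<subseteq> tail 0" by (auto simp: tail_def)
  then have "\<forall>x\<in>?F. \<exists>W\<in>\<U>. x \<in> W" using U by blast
  then obtain W where W: "\<And>x. x \<in> ?F \<Longrightarrow> W x \<in> \<U> \<and> x \<in> W x" by metis
  have "tail 0 \<subseteq> tail (s 0) \<union> ?F" unfolding tail_def using not_less by auto
  moreover have "?F \<subseteq> \<Union> (W ` ?F)"
  proof
    fix x assume x: "x \<in> ?F"
    then have "x \<in> W x" using W by blast
    then show "x \<in> \<Union> (W ` ?F)" using x by blast
  qed
  ultimately have "tail 0 \<subseteq> \<Union> (insert V (W ` ?F))" using tV by auto
  moreover have "finite (insert V (W ` ?F))" using D_finite by simp
  moreover have "insert V (W ` ?F) \<subseteq> \<U>" using V(1) W by auto
  ultimately show "\<exists>\<F>. finite \<F> \<and> \<F> \<subseteq> \<U> \<and> tail 0 \<subseteq> \<Union> \<F>" by blast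
qed

lemma compact_set_product:
  assumes "compactin block_topology A" "compactin block_topology B"
  shows "compactin block_topology {x \<otimes> y |x y. x \<in> A \<and> y \<in> B}"
proof -
  have "compactin (prod_topology block_topology block_topology) (A \<times> B)"
    using assms by (simp add: compactin_Times)
  then have "compactin block_topology ((\<lambda>(x, y). x \<otimes> y) ` (A \<times> B))"
    using group_topology_block_topology image_compactin unfolding group_topology_def by blast
  moreover have "(\<lambda>(x, y). x \<otimes> y) ` (A \<times> B) = {x \<otimes> y |x y. x \<in> A \<and> y \<in> B}" by auto
  ultimately show ?thesis by simp
qed

text \<open>The products of \<open>n\<close> members of the null sequence: compact sets that exhaust the open subgroup \<open>nbhd (\<lambda>_. 0)\<close>.\<close>
abbreviation K :: "nat \<Rightarrow> 'a set" where
  "K n \<equiv> tail_products (\<lambda>_. 0) n"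

lemma compact_K: "compactin block_topology (K n)"
  by (induction n) (auto intro: compact_set_product compact_tail)

text \<open>
  A single neighbourhood can be fitted into \<open>K n \<cdot> nbhd (s n)\<close> for all \<open>n\<close> at once: cut off the first \<open>n\<close> factors and
  let the remaining ones obey \<open>s n\<close>. This diagonal argument is the source of completeness.
\<close>
lemma nbhd_split:
  fixes s :: "nat \<Rightarrow> nat \<Rightarrow> nat"
  shows "\<exists>w. \<forall>n. \<forall>x\<in>nbhd w. \<exists>a\<in>K n. \<exists>b\<in>nbhd (s n). x = a \<otimes> b"
proof -
  \<comment> \<open>The values are such that \<open>s n i \<le> w (n + i)\<close>, so that \<open>w\<close> shifted by \<open>n\<close> dominates \<open>s n\<close>.\<close>
  define w where "w = (\<lambda>m. Max ((\<lambda>n. s n (m - n)) ` {..m}))"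
  have w: "s n i \<le> w (n + i)" for n i
  proof -
    have "s n ((n + i) - n) \<le> w (n + i)" unfolding w_def by (rule Max_ge, simp, rule image_eqI[of _ _ n], simp_all)
    then show ?thesis by simp
  qed
  have "\<exists>a\<in>K n. \<exists>b\<in>nbhd (s n). x = a \<otimes> b" if x: "x \<in> nbhd w" for n x
  proof -
    obtain k where "x \<in> tail_products w k" using x by (auto simp: nbhd_def)
    then have "x \<in> tail_products w (n + k)" using tail_products_mono[of k "n + k" w] by auto
    then obtain a b where ab: "a \<in> tail_products w n" "b \<in> tail_products (\<lambda>i. w (n + i)) k" "x = a \<otimes> b"
      using tail_products_split by blast
    have "a \<in> K n" using ab(1) tail_products_antimono[of "\<lambda>_. 0" w] by blast
    moreover have "b \<in> nbhd (s n)"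
      using ab(2) tail_products_antimono[of "s n" "\<lambda>i. w (n + i)" k] w unfolding nbhd_def by blast
    ultimately show ?thesis using ab by blast
  qed
  then show ?thesis by blast
qed

lemma cauchy_small_set:
  assumes "cauchy_filter_on_group G block_topology F"
  shows "\<exists>P. eventually P F \<and> (\<forall>x. P x \<longrightarrow> x \<in> carrier G) \<and> (\<forall>x y. P x \<and> P y \<longrightarrow> (\<exists>z\<in>nbhd s. x = y \<otimes> z))"
proof -
  have "eventually (\<lambda>(x, y). x \<otimes> inv y \<in> nbhd s) (F \<times>\<^sub>F F)"
    using assms openin_nbhd one_in_nbhd unfolding cauchy_filter_on_group_def by blast
  then obtain Q where Q: "eventually Q F" "\<And>x y. Q x \<Longrightarrow> Q y \<Longrightarrow> x \<otimes> inv y \<in> nbhd s"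
    unfolding eventually_prod_same by auto
  have "eventually (\<lambda>x. x \<in> carrier G) F"
    using assms unfolding cauchy_filter_on_group_def le_principal by blast
  then have "eventually (\<lambda>x. Q x \<and> x \<in> carrier G) F" using Q(1) by (rule eventually_conj[rotated])
  moreover have "\<exists>z\<in>nbhd s. x = y \<otimes> z" if "Q x \<and> x \<in> carrier G" "Q y \<and> y \<in> carrier G" for x y
  proof
    show "x \<otimes> inv y \<in> nbhd s" using Q that by blast
    show "x = y \<otimes> (x \<otimes> inv y)" using that by (simp add: m_lcomm r_inv)
  qed
  ultimately show ?thesis by (intro exI[of _ "\<lambda>x. Q x \<and> x \<in> carrier G"]) blast
qed

text \<open>
  A Cauchy filter lies eventually in one coset \<open>x0 \<cdot> nbhd (\<lambda>_. 0)\<close>. It is then close to one of the compact sets \<open>x0 \<cdot> K n\<close>, in the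
  sense that its members meet every \<open>x0 \<cdot> K n \<cdot> nbhd s\<close>. By compactness it has a cluster point there, and a Cauchy filter
  converges to its cluster points.
\<close>
lemma complete_block_topology: "complete_group_topology G block_topology"
  unfolding complete_group_topology_def
proof (intro allI impI)
  fix F assume F: "cauchy_filter_on_group G block_topology F"
  then have Fbot: "F \<noteq> bot" by (simp add: cauchy_filter_on_group_def)
  obtain P0 where P0: "eventually P0 F" "\<And>x. P0 x \<Longrightarrow> x \<in> carrier G"
     "\<And>x y. P0 x \<Longrightarrow> P0 y \<Longrightarrow> \<exists>z\<in>nbhd (\<lambda>_. 0). x = y \<otimes> z"
    using cauchy_small_set[OF F, of "\<lambda>_. 0"] by blast
  obtain x0 where x0: "P0 x0" using P0(1) Fbot eventually_happens by blast
  have x0c: "x0 \<in> carrier G" using P0(2) x0 .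
  have near: "\<exists>n. \<forall>s. \<not> eventually (\<lambda>x. \<not> (\<exists>a\<in>K n. \<exists>b\<in>nbhd s. x = x0 \<otimes> a \<otimes> b)) F"
  proof (rule ccontr)
    assume "\<not> ?thesis"
    then have "\<forall>n. \<exists>s. eventually (\<lambda>x. \<not> (\<exists>a\<in>K n. \<exists>b\<in>nbhd s. x = x0 \<otimes> a \<otimes> b)) F"
      by simp
    from choice[OF this]
    obtain s where s: "\<forall>n. eventually (\<lambda>x. \<not> (\<exists>a\<in>K n. \<exists>b\<in>nbhd (s n). x = x0 \<otimes> a \<otimes> b)) F"
      by (rule exE)
    \<comment> \<open>A point of the coset has \<open>n\<close> factors for an \<open>n\<close> not known beforehand; splitting off \<open>n\<close> more of them leads to \<open>K (n + n)\<close>.\<close>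
    obtain w where w: "\<And>n x. x \<in> nbhd w \<Longrightarrow> \<exists>a\<in>K n. \<exists>b\<in>nbhd (s (n + n)). x = a \<otimes> b"
      using nbhd_split[of "\<lambda>n. s (n + n)"] by blast
    obtain P where P: "eventually P F" "\<And>x. P x \<Longrightarrow> x \<in> carrier G"
       "\<And>x y. P x \<Longrightarrow> P y \<Longrightarrow> \<exists>z\<in>nbhd w. x = y \<otimes> z"
      using cauchy_small_set[OF F, of w] by blast
    obtain y where y: "P0 y" "P y"
      using eventually_happens[OF eventually_conj[OF P0(1) P(1)]] Fbot by blast
    obtain u where u: "u \<in> nbhd (\<lambda>_. 0)" "y = x0 \<otimes> u" using P0(3) y x0 by blast
    obtain n where n: "u \<in> K n" using u by (auto simp: nbhd_def)
    obtain x where x: "P x" "\<not> (\<exists>a\<in>K (n + n). \<exists>b\<in>nbhd (s (n + n)). x = x0 \<otimes> a \<otimes> b)"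
      using eventually_happens[OF eventually_conj[OF P(1) spec[OF s, of "n + n"]]] Fbot by blast
    obtain z where z: "z \<in> nbhd w" "x = y \<otimes> z" using P(3) x y by blast
    obtain a b where ab: "a \<in> K n" "b \<in> nbhd (s (n + n))" "z = a \<otimes> b" using w[OF z(1)] by blast
    have "u \<otimes> a \<in> K (n + n)" using tail_products_append[of u "\<lambda>_. 0" n a n] n ab by simp
    moreover have "x = x0 \<otimes> (u \<otimes> a) \<otimes> b"
    proof -
      have "u \<in> carrier G" "a \<in> carrier G" "b \<in> carrier G"
        using n ab tail_products_carrier nbhd_carrier by blast+
      then show ?thesis using x0c z(2) u(2) ab(3) by (simp add: m_assoc)
    qed
    ultimately show False using x(2) ab(2) by blast
  qed
  then obtain n where n: "\<And>s. \<not> eventually (\<lambda>x. \<not> (\<exists>a\<in>K n. \<exists>b\<in>nbhd s. x = x0 \<otimes> a \<otimes> b)) F" by blast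
  define C where "C = {x \<otimes> y |x y. x \<in> {x0} \<and> y \<in> K n}"
  have compC: "compactin block_topology C"
    unfolding C_def using x0c by (intro compact_set_product compact_K) simp
  have Cc: "C \<subseteq> carrier G" using compactin_subset_topspace[OF compC] by simp
  have "\<exists>l\<in>C. \<forall>s. \<not> eventually (\<lambda>x. x \<notin> (\<lambda>z. l \<otimes> z) ` nbhd s) F"
  proof (rule ccontr)
    assume "\<not> ?thesis"
    then have "\<forall>l\<in>C. \<exists>s. eventually (\<lambda>x. x \<notin> (\<lambda>z. l \<otimes> z) ` nbhd s) F" by simp
    from bchoice[OF this]
    obtain s where s: "\<forall>l\<in>C. eventually (\<lambda>x. x \<notin> (\<lambda>z. l \<otimes> z) ` nbhd (s l)) F" by (rule exE)
    have "\<forall>l. \<exists>t. \<forall>a\<in>nbhd t. \<forall>b\<in>nbhd t. a \<otimes> b \<in> nbhd (s l)" using nbhd_halve by simp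
    from choice[OF this]
    obtain t where t: "\<forall>l. \<forall>a\<in>nbhd (t l). \<forall>b\<in>nbhd (t l). a \<otimes> b \<in> nbhd (s l)" by (rule exE)
    let ?O = "\<lambda>l. (\<lambda>z. l \<otimes> z) ` nbhd (t l)"
    have "Ball (?O ` C) (openin block_topology)" using openin_translate_nbhd Cc by auto
    moreover have "C \<subseteq> \<Union> (?O ` C)"
    proof
      fix x assume x: "x \<in> C"
      then have "x \<in> ?O x" using in_translate_nbhd Cc by blast
      then show "x \<in> \<Union> (?O ` C)" using x by blast
    qed
    ultimately obtain \<F> where \<F>: "finite \<F>" "\<F> \<subseteq> ?O ` C" "C \<subseteq> \<Union> \<F>"
      using compC unfolding compactin_def by (elim conjE allE[of _ "?O ` C"]) auto
    obtain L where L: "L \<subseteq> C" "finite L" "\<F> = ?O ` L"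
      using finite_subset_image[OF \<F>(1,2)] by blast
    have CL: "C \<subseteq> \<Union> (?O ` L)" using \<F>(3) L(3) by simp
    have "x0 \<otimes> \<one> \<in> C" using one_in_tail_products[of "\<lambda>_. 0" n] unfolding C_def by blast
    then have "L \<noteq> {}" using CL by blast
    let ?r = "\<lambda>i. Max ((\<lambda>s. s i) ` t ` L)"
    have r: "nbhd ?r \<subseteq> (\<Inter>q\<in>t ` L. nbhd q)"
      using L(2) \<open>L \<noteq> {}\<close> by (intro nbhd_finite_Inter) auto
    have "eventually (\<lambda>x. \<forall>l\<in>L. x \<notin> (\<lambda>z. l \<otimes> z) ` nbhd (s l)) F"
      using L(1,2) s by (intro eventually_ball_finite) auto
    then have "eventually (\<lambda>x. \<not> (\<exists>a\<in>K n. \<exists>b\<in>nbhd ?r. x = x0 \<otimes> a \<otimes> b)) F"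
    proof (rule eventually_mono)
      fix x assume x: "\<forall>l\<in>L. x \<notin> (\<lambda>z. l \<otimes> z) ` nbhd (s l)"
      show "\<not> (\<exists>a\<in>K n. \<exists>b\<in>nbhd ?r. x = x0 \<otimes> a \<otimes> b)"
      proof clarify
        fix a b assume ab: "a \<in> K n" "b \<in> nbhd ?r" and xe: "x = x0 \<otimes> a \<otimes> b"
        have "x0 \<otimes> a \<in> C" using ab(1) unfolding C_def by blast
        then obtain l z where l: "l \<in> L" "z \<in> nbhd (t l)" "x0 \<otimes> a = l \<otimes> z" using CL by blast
        have "b \<in> nbhd (t l)" using ab(2) r l(1) by blast
        then have "z \<otimes> b \<in> nbhd (s l)" using t l(2) by blast
        moreover have "x = l \<otimes> (z \<otimes> b)"
        proof -
          have "l \<in> carrier G" "z \<in> carrier G" "b \<in> carrier G"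
            using l(1) L(1) Cc in_nbhd_carrier[OF l(2)] in_nbhd_carrier[OF ab(2)] by blast+
          then show ?thesis using xe l(3) by (simp add: m_assoc)
        qed
        ultimately show False using x l(1) by blast
      qed
    qed
    then show False using n by blast
  qed
  then obtain l where l: "l \<in> C" "\<And>s. \<not> eventually (\<lambda>x. x \<notin> (\<lambda>z. l \<otimes> z) ` nbhd s) F" by blast
  have lc: "l \<in> carrier G" using l Cc by blast
  have "limitin block_topology (\<lambda>x. x) l F"
    unfolding limitin_def
  proof (intro conjI allI impI)
    show "l \<in> topspace block_topology" using lc by simp
    fix U assume U: "openin block_topology U \<and> l \<in> U"
    then obtain s where s: "\<forall>z\<in>nbhd s. l \<otimes> z \<in> U" using openin_block_topology by blast
    obtain t where t: "\<forall>a\<in>nbhd t. \<forall>b\<in>nbhd t. a \<otimes> b \<in> nbhd s" using nbhd_halve by blast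
    obtain P where P: "eventually P F" "\<And>x. P x \<Longrightarrow> x \<in> carrier G"
       "\<And>x y. P x \<Longrightarrow> P y \<Longrightarrow> \<exists>z\<in>nbhd t. x = y \<otimes> z"
      using cauchy_small_set[OF F, of t] by blast
    have "\<exists>y. P y \<and> y \<in> (\<lambda>z. l \<otimes> z) ` nbhd t"
    proof (rule ccontr)
      assume "\<not> ?thesis"
      then have "y \<notin> (\<lambda>z. l \<otimes> z) ` nbhd t" if "P y" for y using that by blast
      from eventually_mono[OF P(1) this]
      have "eventually (\<lambda>x. x \<notin> (\<lambda>z. l \<otimes> z) ` nbhd t) F" .
      then show False using l(2) by blast
    qed
    then obtain y a where y: "P y" "a \<in> nbhd t" "y = l \<otimes> a" by blast
    show "eventually (\<lambda>x. x \<in> U) F"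
      using P(1)
    proof (rule eventually_mono)
      fix x assume "P x"
      then obtain b where b: "b \<in> nbhd t" "x = y \<otimes> b" using P(3) y(1) by blast
      then have "x = l \<otimes> (a \<otimes> b)"
        using y(3) lc in_nbhd_carrier[OF y(2)] in_nbhd_carrier[OF b(1)] by (simp add: m_assoc)
      then show "x \<in> U" using s t y b by blast
    qed
  qed
  then show "\<exists>l. limitin block_topology (\<lambda>x. x) l F" by blast
qed

end

section \<open>Prescribing a countable radical\<close>

lemma (in group) character_finprod:
  assumes "comm_group G" "character h" "f \<in> A \<rightarrow> carrier G"
  shows "h (finprod G f A) = (\<Prod>i\<in>A. h (f i))"
proof -
  interpret comm_group G by fact
  show ?thesis
  proof (cases "finite A")
    case True
    then show ?thesis using assms(3)
    proof (induction A rule: finite_induct)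
      case (insert a A)
      have "finprod G f (insert a A) = f a \<otimes> finprod G f A"
        using insert by (intro finprod_insert) auto
      moreover have "f a \<in> carrier G" "finprod G f A \<in> carrier G" using insert by auto
      ultimately show ?case using insert assms(2) by (simp add: character_mult)
    qed (use assms(2) in simp)
  qed (use assms(2) in simp)
qed

lemma (in comm_group) finprod_update:
  assumes "finite A" "q \<in> A" "f \<in> A \<rightarrow> carrier G" "y \<in> carrier G"
    and g: "\<And>i. i \<in> A \<Longrightarrow> g i = (if i = q then f i \<otimes> y else f i)"
  shows "finprod G g A = finprod G f A \<otimes> y"
proof -
  have "finprod G g A = finprod G (\<lambda>i. f i \<otimes> (if q = i then y else \<one>)) A"
    using assms by (intro finprod_cong') (auto simp: Pi_iff)
  also have "\<dots> = finprod G f A \<otimes> finprod G (\<lambda>i. if q = i then y else \<one>) A"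
    using assms by (intro finprod_multf) auto
  also have "finprod G (\<lambda>i. if q = i then y else \<one>) A = y"
    using assms finprod_singleton[of q A "\<lambda>_. y"] by simp
  finally show ?thesis .
qed

text \<open>
  The sequence \<open>h\<close> lists \<open>H\<close>, \<open>e\<close> is a fresh sequence for it, and \<open>X\<close> stands for the coordinate characters of \<open>G/H\<close>.
\<close>
locale radical_construction = bounded_comm_group G N for G (structure) and N +
  fixes H :: "'a set" and h e :: "nat \<Rightarrow> 'a" and X :: "('a \<Rightarrow> complex) set"
  assumes N_ne_1: "N \<noteq> 1" and H: "subgroup H G"
    and h_in: "h k \<in> H" and h_often: "x \<in> H \<Longrightarrow> \<exists>k\<ge>m. h k = x"
    and X_char: "\<xi> \<in> X \<Longrightarrow> character \<xi>" and X_H: "\<lbrakk>\<xi> \<in> X; x \<in> H\<rbrakk> \<Longrightarrow> \<xi> x = 1"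
    and X_sep: "\<lbrakk>x \<in> carrier G; x \<notin> H\<rbrakk> \<Longrightarrow> \<exists>\<xi>\<in>X. \<xi> x \<noteq> 1"
    and e_in: "e i \<in> carrier G"
    and e_ind: "e i [^] (a::int) \<in> generate G (h ` {..i} \<union> e ` {..<i}) \<Longrightarrow> int N dvd a"
    and e_X: "\<lbrakk>\<xi> \<in> X; j < i; \<xi> (e j) \<noteq> 1\<rbrakk> \<Longrightarrow> \<xi> (e i) = 1"
begin

definition block :: "nat \<Rightarrow> nat set" where
  "block k = {2 ^ k..<2 ^ Suc k}"

text \<open>
  Forcing this element to be small together with the \<open>e i\<close> of its block makes \<open>h k\<close> small for every continuous
  character, at the cost of \<open>2 ^ k + 1\<close> factors.
\<close>
definition closing_element :: "nat \<Rightarrow> 'a" where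
  "closing_element k = h k \<otimes> inv (finprod G e (block k))"

definition null_elements :: "nat \<Rightarrow> 'a set" where
  "null_elements k = insert (closing_element k) (e ` block k)"

definition D :: "nat \<Rightarrow> 'a set" where
  "D k = null_elements k \<union> (\<lambda>x. inv x) ` null_elements k"

lemma h_carrier: "h k \<in> carrier G"
  using h_in subgroup.subset[OF H] by blast

lemma closing_element_carrier: "closing_element k \<in> carrier G"
  using h_carrier e_in by (simp add: closing_element_def)

lemma null_elements_carrier: "null_elements k \<subseteq> carrier G"
  using closing_element_carrier e_in by (auto simp: null_elements_def)

lemma finite_block [simp]: "finite (block k)"
  by (simp add: block_def)

lemma card_block: "card (block k) = 2 ^ k"
  by (simp add: block_def)

lemma block_disjoint: "\<lbrakk>i \<in> block k; i \<in> block k'\<rbrakk> \<Longrightarrow> k = k'"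
proof (rule ccontr)
  assume i: "i \<in> block k" "i \<in> block k'" and "k \<noteq> k'"
  then consider "Suc k \<le> k'" | "Suc k' \<le> k" by linarith
  then show False
  proof cases
    case 1
    then have "(2::nat) ^ Suc k \<le> 2 ^ k'" by (rule power_increasing) simp
    then show False using i by (simp add: block_def)
  next
    case 2
    then have "(2::nat) ^ Suc k' \<le> 2 ^ k" by (rule power_increasing) simp
    then show False using i by (simp add: block_def)
  qed
qed

sublocale vanishing_blocks G D
proof
  show "finite (D k)" for k by (simp add: D_def null_elements_def)
  show "D k \<subseteq> carrier G" for k using null_elements_carrier by (auto simp: D_def)
  show "inv x \<in> D k" if xD: "x \<in> D k" for x k
  proof -
    consider "x \<in> null_elements k" | y where "y \<in> null_elements k" "x = inv y" using xD by (auto simp: D_def)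
    then show ?thesis
    proof cases
      case 1
      then show ?thesis by (simp add: D_def)
    next
      case 2
      then have "y \<in> carrier G" using null_elements_carrier[of k] by blast
      then have "inv x = y" using 2 by simp
      then show ?thesis using 2 by (simp add: D_def)
    qed
  qed
qed

lemma character_trivial_on_D:
  assumes "character \<xi>" "\<And>x. x \<in> null_elements k \<Longrightarrow> \<xi> x = 1" "x \<in> D k"
  shows "\<xi> x = 1"
proof -
  consider "x \<in> null_elements k" | y where "y \<in> null_elements k" "x = inv y" using assms(3) by (auto simp: D_def)
  then show ?thesis
  proof cases
    case 1
    then show ?thesis using assms by blast
  next
    case 2
    then have "y \<in> carrier G" using null_elements_carrier by auto
    then show ?thesis using assms(1) assms(2)[OF 2(1)] 2 by (simp add: character_inv)
  qed
qed

lemma character_trivial_on_nbhd: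
  assumes \<xi>: "character \<xi>" and triv: "\<And>k x. \<lbrakk>m \<le> k; x \<in> null_elements k\<rbrakk> \<Longrightarrow> \<xi> x = 1"
    and x: "x \<in> nbhd (\<lambda>_. m)"
  shows "\<xi> x = 1"
proof -
  have tail: "\<xi> y = 1" if y: "y \<in> tail m" for y
  proof (cases "y = \<one>")
    case True
    then show ?thesis using \<xi> by simp
  next
    case False
    then obtain k where k: "m \<le> k" "y \<in> D k" using y by (auto simp: tail_def)
    show ?thesis using character_trivial_on_D[OF \<xi> triv[OF k(1)] k(2)] .
  qed
  have "\<xi> y = 1" if "y \<in> tail_products (\<lambda>_. m) k" for y k
    using that
  proof (induction k arbitrary: y)
    case (Suc k)
    then obtain a b where ab: "y = a \<otimes> b" "a \<in> tail_products (\<lambda>_. m) k" "b \<in> tail m" by auto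
    then show ?case
      using Suc.IH tail \<xi> in_tail_products_carrier[OF ab(2)] in_tail_carrier[OF ab(3)] by (simp add: character_mult)
  qed (use \<xi> in simp)
  then show ?thesis using x by (auto simp: nbhd_def)
qed

lemma X_trivial_on_nbhd:
  assumes \<xi>: "\<xi> \<in> X"
  shows "\<exists>m. \<forall>x\<in>nbhd (\<lambda>_. m). \<xi> x = 1"
proof -
  obtain m where m: "\<And>i. m \<le> i \<Longrightarrow> \<xi> (e i) = 1"
  proof (cases "\<exists>j. \<xi> (e j) \<noteq> 1")
    case True
    then obtain j where j: "\<xi> (e j) \<noteq> 1" by blast
    show ?thesis
    proof (rule that[of "Suc j"])
      show "\<xi> (e i) = 1" if "Suc j \<le> i" for i using e_X[OF \<xi> _ j] that by simp
    qed
  next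
    case False
    then show ?thesis using that[of 0] by blast
  qed
  have \<xi>c: "character \<xi>" using X_char[OF \<xi>] .
  have triv: "\<xi> x = 1" if k: "m \<le> k" and x: "x \<in> null_elements k" for k x
  proof -
    have e1: "\<xi> (e i) = 1" if "i \<in> block k" for i
    proof (rule m)
      have "2 ^ k \<le> i" using that by (simp add: block_def)
      then show "m \<le> i" using k less_exp[of k] by linarith
    qed
    have ec: "e \<in> block k \<rightarrow> carrier G" using e_in by simp
    have "\<xi> (finprod G e (block k)) = 1"
      using character_finprod[OF comm_group_axioms \<xi>c ec] e1 by simp
    then have "\<xi> (closing_element k) = 1"
      using \<xi>c h_carrier ec X_H[OF \<xi> h_in] by (simp add: closing_element_def character_mult character_inv)
    then show ?thesis using x e1 by (auto simp: null_elements_def)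
  qed
  have "\<forall>x\<in>nbhd (\<lambda>_. m). \<xi> x = 1"
  proof
    fix x assume x: "x \<in> nbhd (\<lambda>_. m)"
    show "\<xi> x = 1"
    proof (rule character_trivial_on_nbhd)
      show "character \<xi>" by (rule \<xi>c)
      show "\<xi> y = 1" if "m \<le> k" "y \<in> null_elements k" for k y using triv[OF that] .
      show "x \<in> nbhd (\<lambda>_. m)" by (rule x)
    qed
  qed
  then show ?thesis by blast
qed

text \<open>
  The values of \<open>\<xi>\<close> are \<open>N\<close>-th roots of unity, among which \<open>1\<close> is isolated, so \<open>\<xi>\<close> is exactly \<open>1\<close> on all late blocks;
  and \<open>x\<close> is the product of the members of some late block.
\<close>
lemma continuous_character_trivial_on_H:
  assumes \<xi>: "\<xi> \<in> continuous_characters G block_topology" and x: "x \<in> H"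
  shows "\<xi> x = 1"
proof -
  have \<xi>c: "character \<xi>" and cont: "continuous_map block_topology (top_of_set (sphere 0 1)) \<xi>"
    using \<xi> by (auto simp: continuous_characters_def)
  let ?R = "{z::complex. z ^ N = 1} - {1}"
  have "open (- ?R)" using finite_N_roots by (intro open_Compl finite_imp_closed) simp
  then have "openin (top_of_set (sphere 0 1)) (sphere 0 1 \<inter> - ?R)" by (rule openin_open_Int)
  then have op: "openin block_topology {y \<in> topspace block_topology. \<xi> y \<in> sphere 0 1 \<inter> - ?R}"
    by (rule openin_continuous_map_preimage[OF cont])
  have "\<one> \<in> {y \<in> topspace block_topology. \<xi> y \<in> sphere 0 1 \<inter> - ?R}" using \<xi>c by simp
  then obtain s where s: "\<forall>z\<in>nbhd s. \<one> \<otimes> z \<in> {y \<in> topspace block_topology. \<xi> y \<in> sphere 0 1 \<inter> - ?R}"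
    using op openin_block_topology by blast
  have triv: "\<xi> y = 1" if y: "y \<in> D k" "s 0 \<le> k" for y k
  proof -
    have "y \<in> tail (s 0)" using y by (auto simp: tail_def)
    then have yn: "y \<in> nbhd s" using tail_subset_nbhd by blast
    then have yc: "y \<in> carrier G" by (rule in_nbhd_carrier)
    have "\<xi> y \<notin> ?R" using s yn yc by auto
    then show ?thesis using character_root[OF \<xi>c yc] by simp
  qed
  obtain k where k: "s 0 \<le> k" "h k = x" using h_often[OF x] by blast
  have e1: "\<xi> (e i) = 1" if "i \<in> block k" for i
    using triv[OF _ k(1), of "e i"] that by (simp add: D_def null_elements_def)
  have v1: "\<xi> (closing_element k) = 1" using triv[OF _ k(1), of "closing_element k"] by (simp add: D_def null_elements_def)
  have ec: "e \<in> block k \<rightarrow> carrier G" using e_in by simp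
  have fc: "finprod G e (block k) \<in> carrier G" using ec by (rule finprod_closed)
  have "closing_element k \<otimes> finprod G e (block k) = x"
    using h_carrier[of k] fc k(2) by (simp add: closing_element_def m_assoc l_inv)
  then have "\<xi> x = \<xi> (closing_element k) * \<xi> (finprod G e (block k))"
    using character_mult[OF \<xi>c closing_element_carrier fc] by metis
  then show ?thesis using v1 e1 character_finprod[OF comm_group_axioms \<xi>c ec] by simp
qed

lemma X_continuous:
  assumes \<xi>: "\<xi> \<in> X"
  shows "\<xi> \<in> continuous_characters G block_topology"
proof -
  obtain m where "\<forall>x\<in>nbhd (\<lambda>_. m). \<xi> x = 1" using X_trivial_on_nbhd[OF \<xi>] by blast
  then show ?thesis
    using character_trivial_on_open_continuous[OF group_topology_block_topology openin_nbhd _ X_char[OF \<xi>], of "\<lambda>_. m"]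
    by simp
qed

lemma von_Neumann_radical_block_topology: "von_Neumann_radical G block_topology = H"
proof
  show "H \<subseteq> von_Neumann_radical G block_topology"
    using continuous_character_trivial_on_H subgroup.subset[OF H]
    by (auto simp: von_Neumann_radical_def kernel_def)
  show "von_Neumann_radical G block_topology \<subseteq> H"
  proof
    fix x assume x: "x \<in> von_Neumann_radical G block_topology"
    have "(\<lambda>_. 1) \<in> continuous_characters G block_topology"
      by (simp add: continuous_characters_def hom_def)
    then have xc: "x \<in> carrier G" using x by (auto simp: von_Neumann_radical_def kernel_def)
    show "x \<in> H"
    proof (rule ccontr)
      assume "x \<notin> H"
      then obtain \<xi> where "\<xi> \<in> X" "\<xi> x \<noteq> 1" using X_sep xc by blast
      then show False using x X_continuous by (auto simp: von_Neumann_radical_def kernel_def)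
    qed
  qed
qed

lemma e_ne_one: "e i \<noteq> \<one>"
proof
  assume "e i = \<one>"
  then have "e i [^] (1::int) \<in> generate G (h ` {..i} \<union> e ` {..<i})" by (simp add: generate.one)
  then have "int N dvd 1" by (rule e_ind)
  then show False using N_ne_1 by simp
qed

lemma block_topology_not_discrete: "block_topology \<noteq> discrete_topology (carrier G)"
proof
  assume "block_topology = discrete_topology (carrier G)"
  then have "openin block_topology {\<one>}" by simp
  then obtain s where s: "\<forall>z\<in>nbhd s. \<one> \<otimes> z \<in> {\<one>}" using openin_block_topology by blast
  have "2 ^ s 0 \<in> block (s 0)" by (simp add: block_def)
  then have "e (2 ^ s 0) \<in> D (s 0)" by (simp add: D_def null_elements_def)
  then have "e (2 ^ s 0) \<in> tail (s 0)" by (auto simp: tail_def)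
  then have "e (2 ^ s 0) \<in> nbhd s" using tail_subset_nbhd by blast
  then show False using s e_in e_ne_one by auto
qed

definition filtration :: "nat \<Rightarrow> 'a set" where
  "filtration i = generate G (h ` {..i} \<union> e ` {..<i})"

lemma filtration_subgroup: "subgroup (filtration i) G"
  unfolding filtration_def using h_carrier e_in by (intro generate_is_subgroup) auto

lemma filtration_mono: "i \<le> j \<Longrightarrow> filtration i \<subseteq> filtration j"
  unfolding filtration_def by (intro mono_generate) auto

lemma h_filtration: "k \<le> i \<Longrightarrow> h k \<in> filtration i"
  unfolding filtration_def by (auto intro: generate.incl)

lemma e_filtration: "j < i \<Longrightarrow> e j \<in> filtration i"
  unfolding filtration_def by (auto intro: generate.incl)

text \<open>Compare the terms from the last one downwards: each \<open>e i\<close> is independent of everything before it.\<close>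
lemma triangular_independence:
  assumes "finprod G (\<lambda>i. e i [^] (c i :: int)) {a..<b} \<in> filtration a" "i \<in> {a..<b}"
  shows "int N dvd c i"
  using assms
proof (induction b arbitrary: i)
  case (Suc b)
  then have ab: "a \<le> b" by auto
  let ?f = "\<lambda>i. e i [^] c i"
  let ?r = "finprod G ?f {a..<b}"
  have fc: "?f i \<in> carrier G" for i using e_in by simp
  then have rc: "?r \<in> carrier G" by (intro finprod_closed) auto
  have "{a..<Suc b} = insert b {a..<b}" using ab by auto
  then have eq: "finprod G ?f {a..<Suc b} = ?f b \<otimes> ?r" using fc by simp
  have rF: "?r \<in> filtration b"
    using e_filtration subgroup_int_pow_closed[OF filtration_subgroup]
    by (intro subgroup_finprod_closed[OF filtration_subgroup]) auto
  have "?f b \<otimes> ?r \<in> filtration b" using Suc.prems(1) eq filtration_mono[OF ab] by auto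
  then have "(?f b \<otimes> ?r) \<otimes> inv ?r \<in> filtration b"
    using rF subgroup.m_closed[OF filtration_subgroup] subgroup.m_inv_closed[OF filtration_subgroup] by blast
  then have "?f b \<in> filtration b" using fc[of b] rc by (simp add: m_assoc r_inv)
  then have Nb: "int N dvd c b" using e_ind unfolding filtration_def by blast
  then have "?f b = \<one>" using int_pow_eq_one_if_dvd e_in by blast
  then have "?r \<in> filtration a" using Suc.prems(1) eq rc by simp
  then show ?case using Suc.IH Suc.prems(2) Nb by (cases "i = b") auto
qed simp

text \<open>
  The contribution of the \<open>k\<close>-th block to a product of members of the null sequence: \<open>d k\<close> counts the occurrences of
  the closing element and \<open>c i\<close> those of \<open>e i\<close>, with signs for inverses.
\<close>
definition block_value :: "(nat \<Rightarrow> int) \<Rightarrow> (nat \<Rightarrow> int) \<Rightarrow> nat \<Rightarrow> 'a" where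
  "block_value d c k = closing_element k [^] d k \<otimes> finprod G (\<lambda>i. e i [^] c i) (block k)"

lemma block_value_carrier: "block_value d c k \<in> carrier G"
  using closing_element_carrier e_in by (simp add: block_value_def)

lemma block_value_trivial:
  assumes "int N dvd d k" "\<And>i. i \<in> block k \<Longrightarrow> int N dvd c i"
  shows "block_value d c k = \<one>"
proof -
  have "finprod G (\<lambda>i. e i [^] c i) (block k) = \<one>"
    using assms(2) int_pow_eq_one_if_dvd e_in by (intro finprod_one_eqI) blast
  moreover have "closing_element k [^] d k = \<one>" using assms(1) closing_element_carrier int_pow_eq_one_if_dvd by blast
  ultimately show ?thesis by (simp add: block_value_def)
qed

lemma block_value_filtration:
  assumes "k < m"
  shows "block_value d c k \<in> filtration (2 ^ m)"
proof -
  let ?F = "filtration (2 ^ m)"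
  have "(2::nat) ^ Suc k \<le> 2 ^ m" using assms by (intro power_increasing) auto
  then have eF: "e i \<in> ?F" if "i \<in> block k" for i
    using that by (intro e_filtration) (simp add: block_def)
  have "k \<le> 2 ^ m" using assms less_exp[of m] by linarith
  then have "h k \<in> ?F" by (rule h_filtration)
  moreover have "finprod G e (block k) \<in> ?F" using eF by (intro subgroup_finprod_closed[OF filtration_subgroup])
  ultimately have "closing_element k \<in> ?F"
    unfolding closing_element_def using subgroup.m_closed[OF filtration_subgroup] subgroup.m_inv_closed[OF filtration_subgroup] by blast
  then have "closing_element k [^] d k \<in> ?F" using subgroup_int_pow_closed[OF filtration_subgroup] by blast
  moreover have "finprod G (\<lambda>i. e i [^] c i) (block k) \<in> ?F"
    using eF subgroup_int_pow_closed[OF filtration_subgroup] by (intro subgroup_finprod_closed[OF filtration_subgroup]) blast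
  ultimately show ?thesis
    unfolding block_value_def using subgroup.m_closed[OF filtration_subgroup] by blast
qed

text \<open>
  Up to a power of \<open>h k\<close>, the block value is the product of the \<open>e i\<close> with exponents \<open>c i - d k\<close>, so independence makes all \<open>c i\<close>
  congruent to \<open>d k\<close> modulo \<open>N\<close>. A single unused \<open>e i\<close> then forces all the exponents to vanish modulo \<open>N\<close>.
\<close>
lemma block_value_forced_trivial:
  assumes F: "block_value d c k \<in> filtration (2 ^ k)" and gap: "i0 \<in> block k" "c i0 = 0"
  shows "block_value d c k = \<one>"
proof -
  let ?F = "filtration (2 ^ k)"
  let ?E = "finprod G e (block k)" and ?C = "finprod G (\<lambda>i. e i [^] c i) (block k)"
  let ?B = "finprod G (\<lambda>i. e i [^] (c i - d k)) (block k)"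
  have Ec: "?E \<in> carrier G" and Cc: "?C \<in> carrier G" and Bc: "?B \<in> carrier G"
    using e_in by (auto intro: finprod_closed)
  have "?C = finprod G (\<lambda>i. e i [^] (c i - d k) \<otimes> e i [^] d k) (block k)"
    using e_in by (intro finprod_cong') (auto simp flip: int_pow_mult)
  also have "\<dots> = ?B \<otimes> finprod G (\<lambda>i. e i [^] d k) (block k)"
    using e_in by (intro finprod_multf) auto
  also have "finprod G (\<lambda>i. e i [^] d k) (block k) = ?E [^] d k"
    using e_in by (intro finprod_int_pow[symmetric]) auto
  finally have C: "?C = ?B \<otimes> ?E [^] d k" .
  have "closing_element k [^] d k = h k [^] d k \<otimes> inv (?E [^] d k)"
    unfolding closing_element_def using h_carrier[of k] Ec by (simp add: int_pow_distrib int_pow_inv)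
  moreover have "(P \<otimes> inv Q) \<otimes> (?B \<otimes> Q) = P \<otimes> ?B" if "P \<in> carrier G" "Q \<in> carrier G" for P Q
  proof -
    have "inv Q \<otimes> (?B \<otimes> Q) = inv Q \<otimes> (Q \<otimes> ?B)" using that Bc by (simp add: m_comm)
    also have "\<dots> = ?B" using that Bc by (simp add: m_assoc[symmetric] l_inv)
    finally show ?thesis using that Bc by (simp add: m_assoc)
  qed
  ultimately have bv: "block_value d c k = h k [^] d k \<otimes> ?B"
    unfolding block_value_def C using h_carrier[of k] Ec by simp
  have "k \<le> 2 ^ k" by (rule less_imp_le[OF less_exp])
  then have "h k \<in> ?F" by (rule h_filtration)
  then have "inv (h k [^] d k) \<in> ?F"
    using subgroup_int_pow_closed[OF filtration_subgroup] subgroup.m_inv_closed[OF filtration_subgroup] by blast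
  then have "inv (h k [^] d k) \<otimes> block_value d c k \<in> ?F"
    using F subgroup.m_closed[OF filtration_subgroup] by blast
  then have "?B \<in> ?F" unfolding bv using h_carrier[of k] Bc by (simp add: m_assoc[symmetric] l_inv)
  then have dvd: "int N dvd c i - d k" if "i \<in> block k" for i
    using triangular_independence[of "\<lambda>i. c i - d k" "2 ^ k" "2 ^ Suc k" i] that by (simp add: block_def)
  then have "int N dvd d k" using dvd[OF gap(1)] gap(2) by simp
  moreover have "int N dvd c i" if "i \<in> block k" for i
    using dvd[OF that] calculation by (metis diff_add_cancel dvd_add)
  ultimately show ?thesis by (rule block_value_trivial)
qed

text \<open>
  The blocks are removed from the last one downwards. The last block value is the quotient of \<open>x\<close> by the earlier ones, hence
  lies in the filtration before its own \<open>e i\<close> appear, and is trivial by the preceding lemma.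
\<close>
lemma product_of_cheap_blocks:
  assumes "x \<in> filtration (2 ^ Suc j)" and x: "x = finprod G (block_value d c) {..<R}"
    and low: "\<And>k. k \<le> j \<Longrightarrow> block_value d c k = \<one>"
    and gap: "\<And>k. \<exists>i\<in>block k. c i = 0"
  shows "x = \<one>"
  using x
proof (induction R)
  case (Suc R)
  let ?r = "finprod G (block_value d c) {..<R}"
  have rc: "?r \<in> carrier G" using block_value_carrier by (intro finprod_closed) auto
  have eq: "x = block_value d c R \<otimes> ?r"
    using Suc.prems block_value_carrier by (simp add: lessThan_Suc)
  have "block_value d c R = \<one>"
  proof (cases "R \<le> j")
    case True
    then show ?thesis by (rule low)
  next
    case False
    have "(2::nat) ^ Suc j \<le> 2 ^ R" using False by (intro power_increasing) auto
    then have xF: "x \<in> filtration (2 ^ R)" using assms(1) filtration_mono by blast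
    have "?r \<in> filtration (2 ^ R)"
      using block_value_filtration by (intro subgroup_finprod_closed[OF filtration_subgroup]) auto
    then have "x \<otimes> inv ?r \<in> filtration (2 ^ R)"
      using xF subgroup.m_closed[OF filtration_subgroup] subgroup.m_inv_closed[OF filtration_subgroup] by blast
    then have "block_value d c R \<in> filtration (2 ^ R)"
      unfolding eq using block_value_carrier rc by (simp add: m_assoc r_inv)
    then show ?thesis using gap[of R] block_value_forced_trivial by blast
  qed
  then have "x = ?r" using eq rc by simp
  then show ?case by (rule Suc.IH)
qed simp

text \<open>
  Sorts the factors of a product by blocks. The numbers of factors admitted from each block bound the
  number of distinct \<open>e i\<close> that occur. The bound \<open>R0\<close> is any index beyond the blocks that occur; stating the
  equation for all larger \<open>R\<close> lets two factors with different bounds be combined.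
\<close>
lemma tail_products_block_representation:
  assumes "x \<in> tail_products s k"
  shows "\<exists>d c R0. (\<forall>R\<ge>R0. x = finprod G (block_value d c) {..<R}) \<and>
     (\<forall>q. card {i \<in> block q. c i \<noteq> 0} \<le> card {l. l < k \<and> s l \<le> q}) \<and>
     (\<forall>q. d q \<noteq> 0 \<longrightarrow> (\<exists>l<k. s l \<le> q))"
  using assms
proof (induction k arbitrary: x)
  case 0
  have "block_value (\<lambda>_. 0) (\<lambda>_. 0) = (\<lambda>_. \<one>)" by (simp add: block_value_trivial fun_eq_iff)
  then show ?case using 0 by (intro exI[of _ "\<lambda>_. 0"] exI[of _ 0]) simp
next
  case (Suc k)
  then obtain a y where x: "x = a \<otimes> y" "a \<in> tail_products s k" "y \<in> tail (s k)" by auto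
  obtain d c R0 where R0: "\<And>R. R \<ge> R0 \<Longrightarrow> a = finprod G (block_value d c) {..<R}"
    and card: "\<And>q. card {i \<in> block q. c i \<noteq> 0} \<le> card {l. l < k \<and> s l \<le> q}"
    and d: "\<And>q. d q \<noteq> 0 \<Longrightarrow> \<exists>l<k. s l \<le> q"
    using Suc.IH[OF x(2)] by blast
  have ac: "a \<in> carrier G" and yc: "y \<in> carrier G"
    using in_tail_products_carrier[OF x(2)] in_tail_carrier[OF x(3)] by auto
  have more: "card {l. l < k \<and> s l \<le> q} \<le> card {l. l < Suc k \<and> s l \<le> q}" for q
    by (intro card_mono) auto
  have more': "card {l. l < Suc k \<and> s l \<le> q} = Suc (card {l. l < k \<and> s l \<le> q})" if "s k \<le> q" for q
  proof -
    have "{l. l < Suc k \<and> s l \<le> q} = insert k {l. l < k \<and> s l \<le> q}" using that by (auto simp: less_Suc_eq)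
    then show ?thesis by simp
  qed
  have step: ?case
    if q: "s k \<le> q" and upd: "\<And>k'. block_value d' c' k' = (if k' = q then block_value d c k' \<otimes> y else block_value d c k')"
      and c': "\<And>q'. card {i \<in> block q'. c' i \<noteq> 0} \<le> card {i \<in> block q'. c i \<noteq> 0} + (if q' = q then 1 else 0)"
      and d': "\<And>q'. q' \<noteq> q \<Longrightarrow> d' q' = d q'" for q d' c'
  proof (rule exI[of _ d'], rule exI[of _ c'], rule exI[of _ "max R0 (Suc q)"], intro conjI allI impI)
    fix R assume R: "max R0 (Suc q) \<le> R"
    have "finprod G (block_value d' c') {..<R} = finprod G (block_value d c) {..<R} \<otimes> y"
      using R block_value_carrier yc upd by (intro finprod_update[of _ q]) auto
    moreover have "a = finprod G (block_value d c) {..<R}" using R by (intro R0) simp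
    ultimately show "x = finprod G (block_value d' c') {..<R}" using x(1) by metis
  next
    fix q'
    show "card {i \<in> block q'. c' i \<noteq> 0} \<le> card {l. l < Suc k \<and> s l \<le> q'}"
    proof (cases "q' = q")
      case True
      then show ?thesis using c'[of q'] card[of q'] more'[of q'] q by simp
    next
      case False
      then show ?thesis using c'[of q'] card[of q'] more[of q'] by simp
    qed
  next
    fix q' assume ne: "d' q' \<noteq> 0"
    show "\<exists>l<Suc k. s l \<le> q'"
    proof (cases "q' = q")
      case True
      then show ?thesis using q by blast
    next
      case False
      then obtain l where "l < k" "s l \<le> q'" using d[of q'] ne d'[OF False] by auto
      then show ?thesis using less_SucI by blast
    qed
  qed
  show ?case
  proof (cases "y = \<one>")
    case True
    then have "x = a" using x(1) ac by simp
    show ?thesis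
    proof (rule exI[of _ d], rule exI[of _ c], rule exI[of _ R0], intro conjI allI impI)
      show "x = finprod G (block_value d c) {..<R}" if "R0 \<le> R" for R using R0[OF that] \<open>x = a\<close> by simp
      show "card {i \<in> block q. c i \<noteq> 0} \<le> card {l. l < Suc k \<and> s l \<le> q}" for q
        using card[of q] more[of q] by linarith
      show "\<exists>l<Suc k. s l \<le> q" if "d q \<noteq> 0" for q using d[OF that] less_SucI by blast
    qed
  next
    case False
    then obtain q where q: "s k \<le> q" "y \<in> D q" using x(3) by (auto simp: tail_def)
    obtain u and \<epsilon> :: int where u: "u \<in> null_elements q" "y = u [^] \<epsilon>"
    proof -
      consider "y \<in> null_elements q" | u where "u \<in> null_elements q" "y = inv u" using q(2) by (auto simp: D_def)
      then show ?thesis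
      proof cases
        case 1
        then have "y = y [^] (1::int)" using yc by simp
        then show ?thesis using that 1 by blast
      next
        case 2
        then have "u \<in> carrier G" using null_elements_carrier by blast
        then have "y = u [^] (- 1 :: int)" using 2(2) by (simp add: int_pow_neg)
        then show ?thesis using that 2(1) by blast
      qed
    qed
    consider "u = closing_element q" | i where "i \<in> block q" "u = e i" using u(1) by (auto simp: null_elements_def)
    then show ?thesis
    proof cases
      case 1
      show ?thesis
      proof (rule step[OF q(1), of "d(q := d q + \<epsilon>)" c])
        fix k'
        show "block_value (d(q := d q + \<epsilon>)) c k' =
          (if k' = q then block_value d c k' \<otimes> y else block_value d c k')"
        proof (cases "k' = q")
          case True
          let ?C = "finprod G (\<lambda>i. e i [^] c i) (block q)"
          have "?C \<in> carrier G" using e_in by (auto intro: finprod_closed)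
          then show ?thesis
            using True u(2) 1 closing_element_carrier[of q] by (simp add: block_value_def int_pow_mult m_ac)
        qed (simp add: block_value_def)
      qed simp_all
    next
      case 2
      show ?thesis
      proof (rule step[OF q(1), of d "c(i := c i + \<epsilon>)"])
        fix k'
        let ?f = "\<lambda>j. e j [^] c j" and ?g = "\<lambda>j. e j [^] ((c(i := c i + \<epsilon>)) j)"
        show "block_value d (c(i := c i + \<epsilon>)) k' =
          (if k' = q then block_value d c k' \<otimes> y else block_value d c k')"
        proof (cases "k' = q")
          case True
          have "finprod G ?g (block q) = finprod G ?f (block q) \<otimes> y"
            using 2 u(2) e_in yc by (intro finprod_update[of _ i]) (auto simp: int_pow_mult)
          moreover have "finprod G ?f (block q) \<in> carrier G" using e_in by (auto intro: finprod_closed)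
          ultimately show ?thesis
            using True yc closing_element_carrier[of q] by (simp add: block_value_def m_assoc)
        next
          case False
          then have "i \<notin> block k'" using 2(1) block_disjoint by blast
          then have "finprod G ?g (block k') = finprod G ?f (block k')"
            using e_in by (intro finprod_cong') auto
          then show ?thesis using False by (simp add: block_value_def)
        qed
      next
        fix q'
        have "{j \<in> block q'. (c(i := c i + \<epsilon>)) j \<noteq> 0} \<subseteq>
          {j \<in> block q'. c j \<noteq> 0} \<union> (if q' = q then {i} else {})"
        proof
          fix j assume j: "j \<in> {j \<in> block q'. (c(i := c i + \<epsilon>)) j \<noteq> 0}"
          show "j \<in> {j \<in> block q'. c j \<noteq> 0} \<union> (if q' = q then {i} else {})"
          proof (cases "j = i")
            case True
            then have "q' = q" using j 2(1) block_disjoint by blast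
            then show ?thesis using True by simp
          next
            case False
            then show ?thesis using j by simp
          qed
        qed
        then have "card {j \<in> block q'. (c(i := c i + \<epsilon>)) j \<noteq> 0} \<le>
          card ({j \<in> block q'. c j \<noteq> 0} \<union> (if q' = q then {i} else {}))"
          by (intro card_mono) auto
        also have "\<dots> \<le> card {j \<in> block q'. c j \<noteq> 0} + card (if q' = q then {i} else {})"
          by (rule card_Un_le)
        also have "card (if q' = q then {i} else {}) = (if q' = q then 1 else 0)" by simp
        finally show "card {j \<in> block q'. (c(i := c i + \<epsilon>)) j \<noteq> 0} \<le>
          card {j \<in> block q'. c j \<noteq> 0} + (if q' = q then 1 else 0)" .
      qed simp
    qed
  qed
qed

text \<open>
  Outside \<open>H\<close> a character from \<open>X\<close> separates. For \<open>x = h j\<close> the neighbourhood given by \<open>s l = l + j + 1\<close> excludes the blocks up to \<open>j\<close> and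
  admits no more than \<open>q - j\<close> factors from the \<open>q\<close>-th block, which is less than its size \<open>2 ^ q\<close>; so
  every block has an unused \<open>e i\<close>.
\<close>
lemma nbhd_separates:
  assumes x: "x \<in> carrier G" "x \<noteq> \<one>"
  shows "\<exists>s. x \<notin> nbhd s"
proof (cases "x \<in> H")
  case False
  then obtain \<xi> where \<xi>: "\<xi> \<in> X" "\<xi> x \<noteq> 1" using X_sep x by blast
  then show ?thesis using X_trivial_on_nbhd[OF \<xi>(1)] by blast
next
  case True
  then obtain j where j: "h j = x" using h_often by blast
  let ?s = "\<lambda>l. l + Suc j"
  have "x \<notin> nbhd ?s"
  proof
    assume "x \<in> nbhd ?s"
    then obtain k where "x \<in> tail_products ?s k" by (auto simp: nbhd_def)
    then obtain d c R0 where R0: "\<And>R. R \<ge> R0 \<Longrightarrow> x = finprod G (block_value d c) {..<R}"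
      and card: "\<And>q. card {i \<in> block q. c i \<noteq> 0} \<le> card {l. l < k \<and> ?s l \<le> q}"
      and d: "\<And>q. d q \<noteq> 0 \<Longrightarrow> \<exists>l<k. ?s l \<le> q"
      using tail_products_block_representation[of x ?s k] by blast
    have count: "card {l. l < k \<and> ?s l \<le> q} \<le> q - j" for q
    proof -
      have "card {l. l < k \<and> ?s l \<le> q} \<le> card {..<q - j}" by (intro card_mono) auto
      then show ?thesis by simp
    qed
    have "x = \<one>"
    proof (rule product_of_cheap_blocks[of x j d c R0])
      have "j \<le> 2 ^ Suc j" using less_exp[of "Suc j"] by linarith
      then show "x \<in> filtration (2 ^ Suc j)" using h_filtration j by blast
      show "x = finprod G (block_value d c) {..<R0}" using R0 by blast
      show "block_value d c q = \<one>" if q: "q \<le> j" for q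
      proof (rule block_value_trivial)
        show "int N dvd d q" using d[of q] q by fastforce
        have "card {i \<in> block q. c i \<noteq> 0} = 0" using card[of q] count[of q] q by simp
        then have "{i \<in> block q. c i \<noteq> 0} = {}" by simp
        then show "int N dvd c i" if "i \<in> block q" for i using that by auto
      qed
      show "\<exists>i\<in>block q. c i = 0" for q
      proof (rule ccontr)
        assume "\<not> ?thesis"
        then have "{i \<in> block q. c i \<noteq> 0} = block q" by blast
        then have "2 ^ q \<le> q - j" using card[of q] count[of q] card_block[of q] by simp
        then show False using less_exp[of q] by linarith
      qed
    qed
    then show False using x by simp
  qed
  then show ?thesis by blast
qed

theorem H_in_NRC: "H \<in> NRC G"
  unfolding NRC_def
  using H group_topology_block_topology complete_block_topology block_topology_not_discrete
    Hausdorff_block_topology[OF nbhd_separates] von_Neumann_radical_block_topology by blast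

end

section \<open>Characterization by leading invariants\<close>

text \<open>The coordinates of \<open>G/H\<close>, pulled back to \<open>G\<close>. Each element has finite support in the decomposition, which yields the finiteness.\<close>
lemma (in bounded_comm_group) quotient_characters:
  assumes H: "subgroup H G"
  shows "\<exists>X. (\<forall>\<xi>\<in>X. character \<xi> \<and> (\<forall>x\<in>H. \<xi> x = 1)) \<and>
    (\<forall>x\<in>carrier G. finite {\<xi> \<in> X. \<xi> x \<noteq> 1}) \<and>
    (\<forall>x\<in>carrier G - H. \<exists>\<xi>\<in>X. \<xi> x \<noteq> 1)"
proof -
  let ?Q = "G Mod H"
  let ?\<pi> = "\<lambda>x. H #> x"
  have normal: "H \<lhd> G" using H by (rule subgroup_imp_normal)
  interpret normal H G by (rule normal)
  interpret Q: comm_group ?Q by (rule abelian_FactGroup[OF H])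
  have \<pi>hom: "?\<pi> \<in> hom G ?Q" by (rule r_coset_hom_Mod)
  then have \<pi>c: "?\<pi> x \<in> carrier ?Q" if "x \<in> carrier G" for x using that by (auto simp: hom_def)
  interpret \<pi>: group_hom G ?Q ?\<pi>
    using \<pi>hom is_group Q.is_group by (simp add: group_hom_def group_hom_axioms_def)
  have "A [^]\<^bsub>?Q\<^esub> N = \<one>\<^bsub>?Q\<^esub>" if A: "A \<in> carrier ?Q" for A
  proof -
    obtain x where x: "x \<in> carrier G" "A = ?\<pi> x" using A unfolding FactGroup_def RCOSETS_def by auto
    have "?\<pi> (x [^] N) = ?\<pi> x [^]\<^bsub>?Q\<^esub> N" using x(1) by (rule \<pi>.hom_nat_pow)
    then show ?thesis using pow_N[OF x(1)] x(2) \<pi>.hom_one by simp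
  qed
  then interpret Q: bounded_comm_group ?Q N using N_pos by unfold_locales
  obtain M n K where dec: "cyclic_decomposition ?Q M n K" using Q.cyclic_decomposition_exists by blast
  obtain \<xi> g where \<xi>: "\<And>t. t \<in> cyclic_index M n K \<Longrightarrow> \<xi> t \<in> hom ?Q circle_group"
    and fin: "\<And>y. y \<in> carrier ?Q \<Longrightarrow> finite {t \<in> cyclic_index M n K. \<xi> t y \<noteq> 1}"
    and sep: "\<And>y. \<lbrakk>y \<in> carrier ?Q; \<forall>t\<in>cyclic_index M n K. \<xi> t y = 1\<rbrakk> \<Longrightarrow> y = \<one>\<^bsub>?Q\<^esub>"
    by (rule cyclic_decomposition_coordinates[OF Q.is_group dec]) (rule that)
  let ?I = "cyclic_index M n K"
  define X where "X = (\<lambda>t. \<xi> t \<circ> ?\<pi>) ` ?I"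
  have triv: "?\<pi> x = \<one>\<^bsub>?Q\<^esub> \<longleftrightarrow> x \<in> H" if "x \<in> carrier G" for x
    using that H by (metis FactGroup_def coset_join1 coset_join2 monoid.select_convs(2) subgroup.subset)
  show ?thesis
  proof (intro exI[of _ X] conjI ballI)
    fix \<eta> assume "\<eta> \<in> X"
    then obtain t where t: "t \<in> ?I" "\<eta> = \<xi> t \<circ> ?\<pi>" unfolding X_def by blast
    show "character \<eta>" unfolding t(2) using Group.hom_compose[OF \<pi>hom \<xi>[OF t(1)]] .
    fix x assume "x \<in> H"
    then have "?\<pi> x = \<one>\<^bsub>?Q\<^esub>" using triv subgroup.subset[OF H] by blast
    then show "\<eta> x = 1" using Q.character_one[OF \<xi>[OF t(1)]] by (simp add: t(2))
  next
    fix x assume x: "x \<in> carrier G"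
    have "{\<eta> \<in> X. \<eta> x \<noteq> 1} \<subseteq> (\<lambda>t. \<xi> t \<circ> ?\<pi>) ` {t \<in> ?I. \<xi> t (?\<pi> x) \<noteq> 1}"
      unfolding X_def by auto
    then show "finite {\<eta> \<in> X. \<eta> x \<noteq> 1}"
      using fin[OF \<pi>c[OF x]] by (meson finite_imageI finite_subset)
  next
    fix x assume x: "x \<in> carrier G - H"
    then have "?\<pi> x \<noteq> \<one>\<^bsub>?Q\<^esub>" using triv by blast
    then obtain t where t: "t \<in> ?I" "\<xi> t (?\<pi> x) \<noteq> 1" using sep[of "?\<pi> x"] \<pi>c x by blast
    then have "\<xi> t \<circ> ?\<pi> \<in> X" "(\<xi> t \<circ> ?\<pi>) x \<noteq> 1" unfolding X_def by auto
    then show "\<exists>\<eta>\<in>X. \<eta> x \<noteq> 1" by blast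
  qed
qed

text \<open>
  The sequence \<open>h\<close> runs through \<open>H\<close> along the first components of all pairs of numbers, so that each element recurs
  infinitely often.
\<close>
theorem (in bounded_comm_group) countable_subgroup_in_NRC:
  assumes infG: "infinite (carrier G)"
    and inf: "\<And>p. \<lbrakk>Factorial_Ring.prime p; p dvd N\<rbrakk> \<Longrightarrow> infinite ((\<lambda>x. x [^] (N div p)) ` carrier G)"
    and H: "subgroup H G" "countable H"
  shows "H \<in> NRC G"
proof -
  have N1: "N \<noteq> 1"
  proof
    assume "N = 1"
    then have "carrier G \<subseteq> {\<one>}" using pow_N by fastforce
    then show False using infG finite_subset by blast
  qed
  define h where "h = (\<lambda>k. from_nat_into H (fst (prod_decode k)))"
  have Hne: "H \<noteq> {}" using subgroup.one_closed[OF H(1)] by blast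
  have hH: "h k \<in> H" for k unfolding h_def using Hne by (rule from_nat_into)
  have often: "\<exists>k\<ge>m. h k = x" if "x \<in> H" for x m
  proof -
    have "x \<in> range (from_nat_into H)" using that Hne H(2) by simp
    then obtain i where "from_nat_into H i = x" by blast
    then have "h (prod_encode (i, m)) = x" by (simp add: h_def)
    then show ?thesis using le_prod_encode_2 by blast
  qed
  have hc: "range h \<subseteq> carrier G" using hH subgroup.subset[OF H(1)] by blast
  obtain X where X: "\<And>\<xi>. \<xi> \<in> X \<Longrightarrow> character \<xi>" "\<And>\<xi> x. \<lbrakk>\<xi> \<in> X; x \<in> H\<rbrakk> \<Longrightarrow> \<xi> x = 1"
    "\<And>x. x \<in> carrier G \<Longrightarrow> finite {\<xi> \<in> X. \<xi> x \<noteq> 1}"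
    "\<And>x. \<lbrakk>x \<in> carrier G; x \<notin> H\<rbrakk> \<Longrightarrow> \<exists>\<xi>\<in>X. \<xi> x \<noteq> 1"
    using quotient_characters[OF H(1)] by (elim exE conjE) (rule that; blast)
  obtain e where e: "range e \<subseteq> carrier G"
    "\<And>i a. e i [^] (a::int) \<in> generate G (h ` {..i} \<union> e ` {..<i}) \<Longrightarrow> int N dvd a"
    "\<And>i j \<xi>. \<lbrakk>\<xi> \<in> X; j < i; \<xi> (e j) \<noteq> 1\<rbrakk> \<Longrightarrow> \<xi> (e i) = 1"
    by (rule fresh_sequence[of h X, OF inf hc X(1) X(3)]) (assumption | rule that)+
  have "radical_construction G N H h e X"
  proof (intro radical_construction.intro radical_construction_axioms.intro)
    show "bounded_comm_group G N" by (rule bounded_comm_group_axioms)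
    show "e i \<in> carrier G" for i using e(1) by blast
    show "int N dvd a" if "e i [^] a \<in> generate G (h ` {..i} \<union> e ` {..<i})" for i and a :: int
      using e(2)[OF that] .
    show "\<xi> (e i) = 1" if "\<xi> \<in> X" "j < i" "\<xi> (e j) \<noteq> 1" for \<xi> i j using e(3)[OF that] .
    show "character \<xi>" if "\<xi> \<in> X" for \<xi> using X(1)[OF that] .
    show "\<xi> x = 1" if "\<xi> \<in> X" "x \<in> H" for \<xi> x using X(2)[OF that] .
    show "\<exists>\<xi>\<in>X. \<xi> x \<noteq> 1" if "x \<in> carrier G" "x \<notin> H" for x using X(4)[OF that] .
    show "\<exists>k\<ge>m. h k = x" if "x \<in> H" for x m using often[OF that] .
  qed (rule N1 H(1) hH)+
  then show ?thesis by (rule radical_construction.H_in_NRC)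
qed

theorem corollary3:
  fixes G :: "('a, 'b) monoid_scheme"
  assumes "comm_group G" and "infinite (carrier G)" and "bounded_group G"
  shows "((\<forall>H. subgroup H G \<and> countable H \<longrightarrow> H \<in> NR G) \<longleftrightarrow>
            (\<forall>\<kappa>\<in>leading_Ulm_Kaplansky_invariants G. BNF_Cardinal_Arithmetic.cinfinite \<kappa>)) \<and>
         ((\<forall>\<kappa>\<in>leading_Ulm_Kaplansky_invariants G. BNF_Cardinal_Arithmetic.cinfinite \<kappa>) \<longrightarrow>
            (\<forall>H. subgroup H G \<and> countable H \<longrightarrow> H \<in> NRC G))"
proof -
  interpret comm_group G by fact
  have cinf: "cinfinite (card_of A) \<longleftrightarrow> infinite A" for A :: "'a set"
    by (simp add: cinfinite_def Field_card_of)
  have "x [^]\<^bsub>G\<^esub> group_exponent G = \<one>\<^bsub>G\<^esub>" if "x \<in> carrier G" for x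
    using that by (simp add: pow_eq_id group_exponent_def)
  then have "bounded_comm_group G (group_exponent G)"
    using assms(3) by unfold_locales (simp_all add: bounded_group_def)
  then obtain M n K where dec: "cyclic_decomposition G M n K"
    using bounded_comm_group.cyclic_decomposition_exists by blast
  have NRC: "\<forall>H. subgroup H G \<and> countable H \<longrightarrow> H \<in> NRC G"
    if inf: "\<forall>\<kappa>\<in>leading_Ulm_Kaplansky_invariants G. cinfinite \<kappa>"
  proof -
    have "infinite (K p (n p))" if "p \<in> M" for p
    proof -
      have "card_of (K p (n p)) \<in> leading_Ulm_Kaplansky_invariants G"
        unfolding leading_Ulm_Kaplansky_invariants_def using dec that by blast
      then show ?thesis using inf cinf by blast
    qed
    then obtain N where N: "bounded_comm_group G N"
      "\<And>p. \<lbrakk>Factorial_Ring.prime p; p dvd N\<rbrakk> \<Longrightarrow> infinite ((\<lambda>x. x [^]\<^bsub>G\<^esub> (N div p)) ` carrier G)"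
      using infinite_leading_invariants_imp_infinite_powers[OF assms(1) dec] by blast
    show ?thesis using bounded_comm_group.countable_subgroup_in_NRC[OF N(1) assms(2) N(2)] by blast
  qed
  have "NRC G \<subseteq> NR G" by (auto simp: NRC_def NR_def)
  moreover have "cinfinite \<kappa>"
    if NR: "\<forall>H. subgroup H G \<and> countable H \<longrightarrow> H \<in> NR G" and \<kappa>: "\<kappa> \<in> leading_Ulm_Kaplansky_invariants G" for \<kappa>
  proof -
    obtain M n K p where "cyclic_decomposition G M n K" "p \<in> M" "\<kappa> = card_of (K p (n p))"
      using \<kappa> unfolding leading_Ulm_Kaplansky_invariants_def by blast
    then show ?thesis
      using finite_leading_invariant_imp_not_NR[OF assms(1), of M n K p] NR cinf by blast
  qed
  ultimately show ?thesis using NRC by blast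
qed

end
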